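(* Let $\mathsf{A}$ be an abelian category and let $\mathsf{W}$ be a special precovering subcategory of $\mathsf{A}$. Suppose that $\mathsf{W}$ is closed under direct summands. Then for each object $M$ in $\mathsf{A}$ the following statements are equivalent: (i) $\mathsf{W}\text{-}\mathrm{pd}_{\mathsf{A}}M<\infty$. (ii) $\widehat{\operatorname{Ext}}{}^{n}_{\mathsf{W}}(-,M)=0=\widehat{\operatorname{Ext}}{}^{n}_{\mathsf{W}}(M,-)$ for all $n\in\mathbb{Z}$. (iii) $\widehat{\operatorname{Ext}}{}^{0}_{\mathsf{W}}(M,M)=0$.
   Context: "Subcategory" means a full additive subcategory closed under isomorphisms; Ext is Yoneda Ext. $\mathsf{W}^{\perp}=\{N\mid\operatorname{Ext}^1_{\mathsf{A}}(W,N)=0\ \forall W\in\mathsf{W}\}$. A special $\mathsf{W}$-precover of $M$ is an exact sequence $0\to K\to W\to M\to0$ with $W\in\mathsf{W}$, $K\in\mathsf{W}^{\perp}$; $\mathsf{W}$ is special precovering if every object has one. A proper $\mathsf{W}$-resolution $P\xrightarrow{\simeq}M$ is a complex $\cdots\to P_1\to P_0\to0$ of objects in $\mathsf{W}$ with $\mathrm{H}_n(P)=0$ for $n>0$ and $\mathrm{H}_0(P)\cong M$, such that $\cdots\to P_1\to P_0\to M\to0$ stays exact under $\operatorname{Hom}_{\mathsf{A}}(W,-)$ for all $W\in\mathsf{W}$. It is special if $\operatorname{Coker}(P_{i+1}\to P_i)\in\mathsf{W}^{\perp}$ for $i\ge1$; special ones exist for all objects. $\mathsf{\Omega}_i^{\mathsf{W}}M$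 is $\operatorname{Coker}(P_{i+1}\to P_i)$ for a chosen special proper $\mathsf{W}$-resolution $P$ of $M$; $\mathsf{\Omega}_0^{\mathsf{W}}M=M$, $\mathsf{\Omega}^{\mathsf{W}}=\mathsf{\Omega}_1^{\mathsf{W}}$. The $\mathsf{W}$-projective dimension is $\mathsf{W}\text{-}\mathrm{pd}_{\mathsf{A}}M=\inf\{\sup\{n\ge0\mid P_n\ne0\}\mid P\xrightarrow{\simeq}M\text{ a proper }\mathsf{W}\text{-resolution}\}$. Complete cohomology. $\underline{\operatorname{Hom}}{}^{\mathsf{W}}_{\mathsf{A}}(M,N)$ is $\operatorname{Hom}_{\mathsf{A}}(M,N)$ modulo the subgroup of morphisms factoring through an object of $\mathsf{W}$. Take special $\mathsf{W}$-precovers $0\to\mathsf{\Omega}^{\mathsf{W}}M\to P_0\to M\to0$ and $0\to\mathsf{\Omega}^{\mathsf{W}}N\to Q_0\to N\to0$. The connecting morphism $\operatorname{Hom}_{\mathsf{A}}(M,N)\to\operatorname{Ext}^1_{\mathsf{A}}(M,\mathsf{\Omega}^{\mathsf{W}}N)$ induces a monomorphism $\overline{\delta}\colon\underline{\operatorname{Hom}}{}^{\mathsf{W}}_{\mathsf{A}}(M,N)\to\operatorname{Ext}^1_{\mathsf{A}}(M,\mathsf{\Omega}^{\mathsf{W}}N)$; the connecting morphism $\partial\colon\operatorname{Hom}_{\mathsf{A}}(\mathsf{\Omega}^{\mathsf{W}}M,\mathsf{\Omega}^{\mathsf{W}}N)\to\operatorname{Ext}^1_{\mathsf{A}}(M,\mathsf{\Omega}^{\mathsf{W}}N)$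 is epi, and there is a unique $\beta\colon\operatorname{Ext}^1_{\mathsf{A}}(M,\mathsf{\Omega}^{\mathsf{W}}N)\to\underline{\operatorname{Hom}}{}^{\mathsf{W}}_{\mathsf{A}}(\mathsf{\Omega}^{\mathsf{W}}M,\mathsf{\Omega}^{\mathsf{W}}N)$ with $\beta\partial$ the canonical projection. Put $\Lambda=\beta\overline{\delta}\colon\underline{\operatorname{Hom}}{}^{\mathsf{W}}_{\mathsf{A}}(M,N)\to\underline{\operatorname{Hom}}{}^{\mathsf{W}}_{\mathsf{A}}(\mathsf{\Omega}^{\mathsf{W}}M,\mathsf{\Omega}^{\mathsf{W}}N)$. Iterating yields, for $n\in\mathbb{Z}$, a direct system over the integers $i\ge\max\{0,-n\}$ and $$\widehat{\operatorname{Ext}}{}^{n}_{\mathsf{W}}(M,N)=\operatorname{colim}_i\underline{\operatorname{Hom}}{}^{\mathsf{W}}_{\mathsf{A}}(\mathsf{\Omega}^{\mathsf{W}}_{i+n}M,\mathsf{\Omega}^{\mathsf{W}}_iN).$$ *)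

theory Defs
  imports "HOL-Algebra.Elementary_Groups" "HOL-Library.Extended_Real"
begin

section \<open>Abelian categories\<close>

text \<open>A category whose hom-sets carry an addition. Every arrow has one source and one target;
  the operations are only meaningful on elements of the carriers \<open>obj\<close> and \<open>arr\<close>.\<close>

record ('o, 'm) precat =
  obj :: "'o set"
  arr :: "'m set"
  src :: "'m \<Rightarrow> 'o"
  tgt :: "'m \<Rightarrow> 'o"
  idt :: "'o \<Rightarrow> 'm"
  comp_mor :: "'m \<Rightarrow> 'm \<Rightarrow> 'm" (infixl "\<cdot>\<index>" 70)
  plus_mor :: "'m \<Rightarrow> 'm \<Rightarrow> 'm"
  zero_mor :: "'o \<Rightarrow> 'o \<Rightarrow> 'm"

definition Hom :: "('o, 'm) precat \<Rightarrow> 'o \<Rightarrow> 'o \<Rightarrow> 'm set" where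
  "Hom A X Y = {f \<in> arr A. src A f = X \<and> tgt A f = Y}"

definition hom_group :: "('o, 'm) precat \<Rightarrow> 'o \<Rightarrow> 'o \<Rightarrow> 'm monoid" where
  "hom_group A X Y = \<lparr>carrier = Hom A X Y, monoid.mult = plus_mor A, one = zero_mor A X Y\<rparr>"

locale category =
  fixes A :: "('o, 'm) precat" (structure)
  assumes src_obj: "f \<in> arr A \<Longrightarrow> src A f \<in> obj A"
    and tgt_obj: "f \<in> arr A \<Longrightarrow> tgt A f \<in> obj A"
    and idt_Hom: "X \<in> obj A \<Longrightarrow> idt A X \<in> Hom A X X"
    and comp_Hom: "\<lbrakk>f \<in> Hom A X Y; g \<in> Hom A Y Z\<rbrakk> \<Longrightarrow> g \<cdot> f \<in> Hom A X Z"
    and comp_idt: "f \<in> Hom A X Y \<Longrightarrow> f \<cdot> idt A X = f"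
    and idt_comp: "f \<in> Hom A X Y \<Longrightarrow> idt A Y \<cdot> f = f"
    and comp_assoc: "\<lbrakk>f \<in> Hom A X Y; g \<in> Hom A Y Z; h \<in> Hom A Z V\<rbrakk>
      \<Longrightarrow> h \<cdot> (g \<cdot> f) = (h \<cdot> g) \<cdot> f"

locale preadditive_category = category +
  assumes hom_group: "\<lbrakk>X \<in> obj A; Y \<in> obj A\<rbrakk> \<Longrightarrow> comm_group (hom_group A X Y)"
    and comp_plus: "\<lbrakk>f \<in> Hom A X Y; f' \<in> Hom A X Y; g \<in> Hom A Y Z\<rbrakk>
      \<Longrightarrow> g \<cdot> plus_mor A f f' = plus_mor A (g \<cdot> f) (g \<cdot> f')"
    and plus_comp: "\<lbrakk>f \<in> Hom A X Y; g \<in> Hom A Y Z; g' \<in> Hom A Y Z\<rbrakk>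
      \<Longrightarrow> plus_mor A g g' \<cdot> f = plus_mor A (g \<cdot> f) (g' \<cdot> f)"

definition zero_object :: "('o, 'm) precat \<Rightarrow> 'o \<Rightarrow> bool" where
  "zero_object A Z \<longleftrightarrow>
     Z \<in> obj A \<and> (\<forall>X\<in>obj A. (\<exists>!f. f \<in> Hom A X Z) \<and> (\<exists>!f. f \<in> Hom A Z X))"

definition biproduct ::
  "('o, 'm) precat \<Rightarrow> 'o \<Rightarrow> 'o \<Rightarrow> 'o \<Rightarrow> 'm \<Rightarrow> 'm \<Rightarrow> 'm \<Rightarrow> 'm \<Rightarrow> bool" where
  "biproduct A X Y B i1 i2 p1 p2 \<longleftrightarrow>
     i1 \<in> Hom A X B \<and> i2 \<in> Hom A Y B \<and> p1 \<in> Hom A B X \<and> p2 \<in> Hom A B Y \<and>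
     p1 \<cdot>\<^bsub>A\<^esub> i1 = idt A X \<and> p2 \<cdot>\<^bsub>A\<^esub> i2 = idt A Y \<and>
     p1 \<cdot>\<^bsub>A\<^esub> i2 = zero_mor A Y X \<and> p2 \<cdot>\<^bsub>A\<^esub> i1 = zero_mor A X Y \<and>
     plus_mor A (i1 \<cdot>\<^bsub>A\<^esub> p1) (i2 \<cdot>\<^bsub>A\<^esub> p2) = idt A B"

definition is_direct_sum :: "('o, 'm) precat \<Rightarrow> 'o \<Rightarrow> 'o \<Rightarrow> 'o \<Rightarrow> bool" where
  "is_direct_sum A X Y B \<longleftrightarrow> (\<exists>i1 i2 p1 p2. biproduct A X Y B i1 i2 p1 p2)"

locale additive_category = preadditive_category +
  assumes ex_zero_object: "\<exists>Z. zero_object A Z"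
    and ex_direct_sum: "\<lbrakk>X \<in> obj A; Y \<in> obj A\<rbrakk> \<Longrightarrow> \<exists>B. is_direct_sum A X Y B"

definition monic :: "('o, 'm) precat \<Rightarrow> 'm \<Rightarrow> bool" where
  "monic A f \<longleftrightarrow> f \<in> arr A \<and>
     (\<forall>X. \<forall>g\<in>Hom A X (src A f). \<forall>h\<in>Hom A X (src A f). f \<cdot>\<^bsub>A\<^esub> g = f \<cdot>\<^bsub>A\<^esub> h \<longrightarrow> g = h)"

definition epic :: "('o, 'm) precat \<Rightarrow> 'm \<Rightarrow> bool" where
  "epic A f \<longleftrightarrow> f \<in> arr A \<and>
     (\<forall>Y. \<forall>g\<in>Hom A (tgt A f) Y. \<forall>h\<in>Hom A (tgt A f) Y. g \<cdot>\<^bsub>A\<^esub> f = h \<cdot>\<^bsub>A\<^esub> f \<longrightarrow> g = h)"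

definition isomorphic :: "('o, 'm) precat \<Rightarrow> 'o \<Rightarrow> 'o \<Rightarrow> bool" where
  "isomorphic A X Y \<longleftrightarrow>
     (\<exists>f\<in>Hom A X Y. \<exists>g\<in>Hom A Y X. g \<cdot>\<^bsub>A\<^esub> f = idt A X \<and> f \<cdot>\<^bsub>A\<^esub> g = idt A Y)"

definition is_kernel :: "('o, 'm) precat \<Rightarrow> 'm \<Rightarrow> 'm \<Rightarrow> bool" where
  "is_kernel A f k \<longleftrightarrow>
     f \<in> arr A \<and> k \<in> arr A \<and> tgt A k = src A f \<and> f \<cdot>\<^bsub>A\<^esub> k = zero_mor A (src A k) (tgt A f) \<and>
     (\<forall>X. \<forall>h\<in>Hom A X (src A f). f \<cdot>\<^bsub>A\<^esub> h = zero_mor A X (tgt A f) \<longrightarrow>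
        (\<exists>!u. u \<in> Hom A X (src A k) \<and> k \<cdot>\<^bsub>A\<^esub> u = h))"

definition is_cokernel :: "('o, 'm) precat \<Rightarrow> 'm \<Rightarrow> 'm \<Rightarrow> bool" where
  "is_cokernel A f q \<longleftrightarrow>
     f \<in> arr A \<and> q \<in> arr A \<and> src A q = tgt A f \<and> q \<cdot>\<^bsub>A\<^esub> f = zero_mor A (src A f) (tgt A q) \<and>
     (\<forall>Y. \<forall>h\<in>Hom A (tgt A f) Y. h \<cdot>\<^bsub>A\<^esub> f = zero_mor A (src A f) Y \<longrightarrow>
        (\<exists>!u. u \<in> Hom A (tgt A q) Y \<and> u \<cdot>\<^bsub>A\<^esub> q = h))"

locale abelian_category = additive_category +
  assumes ex_kernel: "f \<in> arr A \<Longrightarrow> \<exists>k. is_kernel A f k"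
    and ex_cokernel: "f \<in> arr A \<Longrightarrow> \<exists>q. is_cokernel A f q"
    and monic_is_kernel: "monic A k \<Longrightarrow> \<exists>f. is_kernel A f k"
    and epic_is_cokernel: "epic A q \<Longrightarrow> \<exists>f. is_cokernel A f q"

definition is_image :: "('o, 'm) precat \<Rightarrow> 'm \<Rightarrow> 'm \<Rightarrow> bool" where
  "is_image A f m \<longleftrightarrow> (\<exists>q. is_cokernel A f q \<and> is_kernel A q m)"

definition exact_at :: "('o, 'm) precat \<Rightarrow> 'm \<Rightarrow> 'm \<Rightarrow> bool" where
  "exact_at A f g \<longleftrightarrow> (\<exists>m. is_image A f m \<and> is_kernel A g m)"

definition short_exact :: "('o, 'm) precat \<Rightarrow> 'm \<Rightarrow> 'm \<Rightarrow> bool" where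
  "short_exact A i p \<longleftrightarrow> monic A i \<and> exact_at A i p \<and> epic A p"


section \<open>First Yoneda Ext\<close>

text \<open>The extensions \<open>0 \<rightarrow> N \<rightarrow> E \<rightarrow> M \<rightarrow> 0\<close> of \<open>M\<close> by \<open>N\<close>, each given by its two maps.\<close>

definition extensions :: "('o, 'm) precat \<Rightarrow> 'o \<Rightarrow> 'o \<Rightarrow> ('m \<times> 'm) set" where
  "extensions A M N = {(i, p). short_exact A i p \<and> src A i = N \<and> tgt A p = M}"

definition ladder ::
  "('o, 'm) precat \<Rightarrow> 'm \<times> 'm \<Rightarrow> 'm \<times> 'm \<Rightarrow> 'm \<Rightarrow> 'm \<Rightarrow> 'm \<Rightarrow> bool" where
  "ladder A \<xi> \<xi>' a b c \<longleftrightarrow>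
     a \<in> Hom A (src A (fst \<xi>)) (src A (fst \<xi>')) \<and>
     b \<in> Hom A (tgt A (fst \<xi>)) (tgt A (fst \<xi>')) \<and>
     c \<in> Hom A (tgt A (snd \<xi>)) (tgt A (snd \<xi>')) \<and>
     b \<cdot>\<^bsub>A\<^esub> fst \<xi> = fst \<xi>' \<cdot>\<^bsub>A\<^esub> a \<and> c \<cdot>\<^bsub>A\<^esub> snd \<xi> = snd \<xi>' \<cdot>\<^bsub>A\<^esub> b"

definition extension_rel :: "('o, 'm) precat \<Rightarrow> 'o \<Rightarrow> 'o \<Rightarrow> (('m \<times> 'm) \<times> ('m \<times> 'm)) set" where
  "extension_rel A M N = {(\<xi>, \<xi>'). \<xi> \<in> extensions A M N \<and> \<xi>' \<in> extensions A M N \<and>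
     (\<exists>b. ladder A \<xi> \<xi>' (idt A N) b (idt A M))}"

text \<open>Only the underlying set of \<open>Ext\<^sup>1\<close> and its zero, the class of the split extensions, occur
  below, so the Baer sum is not introduced.\<close>

definition Ext1 :: "('o, 'm) precat \<Rightarrow> 'o \<Rightarrow> 'o \<Rightarrow> ('m \<times> 'm) set set" where
  "Ext1 A M N = extensions A M N // extension_rel A M N"

definition Ext1_zero :: "('o, 'm) precat \<Rightarrow> 'o \<Rightarrow> 'o \<Rightarrow> ('m \<times> 'm) set" where
  "Ext1_zero A M N =
     {(i, p) \<in> extensions A M N. \<exists>s\<in>Hom A M (src A p). p \<cdot>\<^bsub>A\<^esub> s = idt A M}"

text \<open>The Yoneda action of maps on extensions: \<open>ext_pullback A \<eta> f\<close> and \<open>ext_pushout A \<xi> g\<close> consist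
  of all extensions that are a pullback of \<open>\<eta>\<close> along \<open>f\<close>, respectively a pushout of \<open>\<xi>\<close> along \<open>g\<close>;
  each is one equivalence class. As functions of \<open>f\<close> and \<open>g\<close> they are the connecting maps of
  \<open>Hom(M, -)\<close> applied to \<open>\<eta>\<close> and of \<open>Hom(-, N)\<close> applied to \<open>\<xi>\<close>.\<close>

definition ext_pullback :: "('o, 'm) precat \<Rightarrow> 'm \<times> 'm \<Rightarrow> 'm \<Rightarrow> ('m \<times> 'm) set" where
  "ext_pullback A \<eta> f = {\<zeta> \<in> extensions A (src A f) (src A (fst \<eta>)).
     \<exists>b. ladder A \<zeta> \<eta> (idt A (src A (fst \<eta>))) b f}"

definition ext_pushout :: "('o, 'm) precat \<Rightarrow> 'm \<times> 'm \<Rightarrow> 'm \<Rightarrow> ('m \<times> 'm) set" where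
  "ext_pushout A \<xi> g = {\<zeta> \<in> extensions A (tgt A (snd \<xi>)) (tgt A g).
     \<exists>b. ladder A \<xi> \<zeta> g b (idt A (tgt A (snd \<xi>)))}"


section \<open>Special precovering subcategories and proper resolutions\<close>

text \<open>A full subcategory is given by its set of objects.\<close>

definition additive_subcategory :: "('o, 'm) precat \<Rightarrow> 'o set \<Rightarrow> bool" where
  "additive_subcategory A W \<longleftrightarrow>
     W \<subseteq> obj A \<and> (\<exists>Z\<in>W. zero_object A Z) \<and>
     (\<forall>X\<in>W. \<forall>Y\<in>W. \<forall>B. is_direct_sum A X Y B \<longrightarrow> B \<in> W) \<and>
     (\<forall>X\<in>W. \<forall>Y. isomorphic A X Y \<longrightarrow> Y \<in> W)"

definition closed_under_summands :: "('o, 'm) precat \<Rightarrow> 'o set \<Rightarrow> bool" where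
  "closed_under_summands A W \<longleftrightarrow> (\<forall>B\<in>W. \<forall>X Y. is_direct_sum A X Y B \<longrightarrow> X \<in> W)"

definition right_perp :: "('o, 'm) precat \<Rightarrow> 'o set \<Rightarrow> 'o set" where
  "right_perp A W = {N \<in> obj A. \<forall>V\<in>W. Ext1 A V N = {Ext1_zero A V N}}"

definition special_precover :: "('o, 'm) precat \<Rightarrow> 'o set \<Rightarrow> 'o \<Rightarrow> 'm \<times> 'm \<Rightarrow> bool" where
  "special_precover A W M \<xi> \<longleftrightarrow>
     \<xi> \<in> extensions A M (src A (fst \<xi>)) \<and> src A (snd \<xi>) \<in> W \<and> src A (fst \<xi>) \<in> right_perp A W"

definition special_precovering :: "('o, 'm) precat \<Rightarrow> 'o set \<Rightarrow> bool" where
  "special_precovering A W \<longleftrightarrow>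
     additive_subcategory A W \<and> (\<forall>M\<in>obj A. \<exists>\<xi>. special_precover A W M \<xi>)"

text \<open>An augmented complex \<open>\<dots> \<rightarrow> P\<^sub>1 \<rightarrow> P\<^sub>0 \<rightarrow> M\<close>: \<open>bd R 0\<close> is the augmentation \<open>P\<^sub>0 \<rightarrow> M\<close> and
  \<open>bd R (Suc n)\<close> is the differential \<open>P\<^sub>n\<^sub>+\<^sub>1 \<rightarrow> P\<^sub>n\<close>.\<close>

record ('o, 'm) resolution =
  cx :: "nat \<Rightarrow> 'o"
  bd :: "nat \<Rightarrow> 'm"

definition proper_resolution ::
  "('o, 'm) precat \<Rightarrow> 'o set \<Rightarrow> 'o \<Rightarrow> ('o, 'm, 'z) resolution_scheme \<Rightarrow> bool" where
  "proper_resolution A W M R \<longleftrightarrow>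
     (\<forall>n. cx R n \<in> W) \<and>
     bd R 0 \<in> Hom A (cx R 0) M \<and> (\<forall>n. bd R (Suc n) \<in> Hom A (cx R (Suc n)) (cx R n)) \<and>
     is_cokernel A (bd R 1) (bd R 0) \<and>
     (\<forall>n. exact_at A (bd R (Suc (Suc n))) (bd R (Suc n))) \<and>
     (\<forall>V\<in>W. (\<lambda>g. bd R 0 \<cdot>\<^bsub>A\<^esub> g) ` Hom A V (cx R 0) = Hom A V M \<and>
       (\<forall>n. {f \<in> Hom A V (cx R n). bd R n \<cdot>\<^bsub>A\<^esub> f = zero_mor A V (tgt A (bd R n))}
            = (\<lambda>g. bd R (Suc n) \<cdot>\<^bsub>A\<^esub> g) ` Hom A V (cx R (Suc n))))"

text \<open>In \<^typ>\<open>ereal\<close> the supremum of the empty set is \<open>-\<infinity>\<close> and its infimum is \<open>\<infinity>\<close>, as usual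
  for homological dimensions.\<close>

definition W_pd :: "('o, 'm) precat \<Rightarrow> 'o set \<Rightarrow> 'o \<Rightarrow> ereal" where
  "W_pd A W M = (INF R \<in> {R :: ('o, 'm) resolution. proper_resolution A W M R}.
     SUP n \<in> {n. \<not> zero_object A (cx R n)}. ereal (real n))"

text \<open>A special proper resolution together with cokernel maps
  \<open>cok R i : P\<^sub>i \<rightarrow> \<Omega>\<^sub>i = Coker (P\<^sub>i\<^sub>+\<^sub>1 \<rightarrow> P\<^sub>i)\<close>; for \<open>i = 0\<close> the cokernel map is the augmentation,
  so that \<open>\<Omega>\<^sub>0 = M\<close>.\<close>

record ('o, 'm) syzygy_resolution = "('o, 'm) resolution" +
  cok :: "nat \<Rightarrow> 'm"

definition Omega :: "('o, 'm) precat \<Rightarrow> ('o, 'm) syzygy_resolution \<Rightarrow> nat \<Rightarrow> 'o" where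
  "Omega A R i = tgt A (cok R i)"

definition special_proper_resolution ::
  "('o, 'm) precat \<Rightarrow> 'o set \<Rightarrow> 'o \<Rightarrow> ('o, 'm) syzygy_resolution \<Rightarrow> bool" where
  "special_proper_resolution A W M R \<longleftrightarrow>
     proper_resolution A W M R \<and> cok R 0 = bd R 0 \<and>
     (\<forall>i\<ge>1. is_cokernel A (bd R (Suc i)) (cok R i) \<and> Omega A R i \<in> right_perp A W)"

definition syzygy_incl :: "('o, 'm) precat \<Rightarrow> ('o, 'm) syzygy_resolution \<Rightarrow> nat \<Rightarrow> 'm" where
  "syzygy_incl A R i = (THE j. j \<in> Hom A (Omega A R (Suc i)) (cx R i) \<and>
     j \<cdot>\<^bsub>A\<^esub> cok R (Suc i) = bd R (Suc i))"

text \<open>The special precover \<open>0 \<rightarrow> \<Omega>\<^sub>i\<^sub>+\<^sub>1 \<rightarrow> P\<^sub>i \<rightarrow> \<Omega>\<^sub>i \<rightarrow> 0\<close>.\<close>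

definition syzygy_seq :: "('o, 'm) precat \<Rightarrow> ('o, 'm) syzygy_resolution \<Rightarrow> nat \<Rightarrow> 'm \<times> 'm" where
  "syzygy_seq A R i = (syzygy_incl A R i, cok R i)"


section \<open>Complete cohomology\<close>

definition factoring :: "('o, 'm) precat \<Rightarrow> 'o set \<Rightarrow> 'o \<Rightarrow> 'o \<Rightarrow> 'm set" where
  "factoring A W M N =
     {f \<in> Hom A M N. \<exists>V\<in>W. \<exists>g\<in>Hom A M V. \<exists>h\<in>Hom A V N. f = h \<cdot>\<^bsub>A\<^esub> g}"

definition stable_hom :: "('o, 'm) precat \<Rightarrow> 'o set \<Rightarrow> 'o \<Rightarrow> 'o \<Rightarrow> 'm set monoid" where
  "stable_hom A W M N = hom_group A M N Mod factoring A W M N"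

definition stable_class :: "('o, 'm) precat \<Rightarrow> 'o set \<Rightarrow> 'o \<Rightarrow> 'o \<Rightarrow> 'm \<Rightarrow> 'm set" where
  "stable_class A W M N f = factoring A W M N #>\<^bsub>hom_group A M N\<^esub> f"

text \<open>In the next three definitions \<open>\<xi> = (0 \<rightarrow> \<Omega>M \<rightarrow> P\<^sub>0 \<rightarrow> M \<rightarrow> 0)\<close> and
  \<open>\<eta> = (0 \<rightarrow> \<Omega>N \<rightarrow> Q\<^sub>0 \<rightarrow> N \<rightarrow> 0)\<close> are special precovers.\<close>

definition delta_bar :: "('o, 'm) precat \<Rightarrow> 'm \<times> 'm \<Rightarrow> 'm set \<Rightarrow> ('m \<times> 'm) set" where
  "delta_bar A \<eta> c = the_elem (ext_pullback A \<eta> ` c)"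

text \<open>The unique \<open>\<beta>\<close> with \<open>\<beta> \<partial>\<close> equal to the canonical projection; \<open>\<partial>\<close> is onto, so \<open>\<beta>\<close> is already
  unique as a map of sets.\<close>

definition beta ::
  "('o, 'm) precat \<Rightarrow> 'o set \<Rightarrow> 'm \<times> 'm \<Rightarrow> 'm \<times> 'm \<Rightarrow> ('m \<times> 'm) set \<Rightarrow> 'm set" where
  "beta A W \<xi> \<eta> =
     (let M = tgt A (snd \<xi>); \<Omega>M = src A (fst \<xi>); \<Omega>N = src A (fst \<eta>) in
      THE \<beta>. \<beta> \<in> Ext1 A M \<Omega>N \<rightarrow>\<^sub>E carrier (stable_hom A W \<Omega>M \<Omega>N) \<and>
        (\<forall>g\<in>Hom A \<Omega>M \<Omega>N. \<beta> (ext_pushout A \<xi> g) = stable_class A W \<Omega>M \<Omega>N g))"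

definition Lambda :: "('o, 'm) precat \<Rightarrow> 'o set \<Rightarrow> 'm \<times> 'm \<Rightarrow> 'm \<times> 'm \<Rightarrow> 'm set \<Rightarrow> 'm set" where
  "Lambda A W \<xi> \<eta> c = beta A W \<xi> \<eta> (delta_bar A \<eta> c)"

text \<open>The colimit of a direct system of abelian groups \<open>G i\<close>, \<open>i \<ge> i0\<close>, with
  \<open>\<phi> i : G i \<rightarrow> G (i + 1)\<close>: the disjoint union of the \<open>G i\<close>, with elements identified when they
  become equal at a later stage. The composite \<open>G i \<rightarrow> G j\<close> is \<open>fold \<phi> [i..<j]\<close>.\<close>

definition colim_rel ::
  "nat \<Rightarrow> (nat \<Rightarrow> 'a monoid) \<Rightarrow> (nat \<Rightarrow> 'a \<Rightarrow> 'a) \<Rightarrow> ((nat \<times> 'a) \<times> (nat \<times> 'a)) set" where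
  "colim_rel i0 G \<phi> = {((i, x), (j, y)). i0 \<le> i \<and> x \<in> carrier (G i) \<and> i0 \<le> j \<and> y \<in> carrier (G j) \<and>
     (\<exists>k. i \<le> k \<and> j \<le> k \<and> fold \<phi> [i..<k] x = fold \<phi> [j..<k] y)}"

definition seq_colim ::
  "nat \<Rightarrow> (nat \<Rightarrow> 'a monoid) \<Rightarrow> (nat \<Rightarrow> 'a \<Rightarrow> 'a) \<Rightarrow> (nat \<times> 'a) set monoid" where
  "seq_colim i0 G \<phi> =
     \<lparr>carrier = (SIGMA i:{i0..}. carrier (G i)) // colim_rel i0 G \<phi>,
      monoid.mult = (\<lambda>c d. colim_rel i0 G \<phi> ``
        {(i, x \<otimes>\<^bsub>G i\<^esub> y) | i x y. (i, x) \<in> c \<and> (i, y) \<in> d}),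
      one = colim_rel i0 G \<phi> `` {(i0, \<one>\<^bsub>G i0\<^esub>)}\<rparr>"

text \<open>\<open>res\<close> assigns to each object its chosen special proper resolution. The argument of \<^const>\<open>nat\<close>
  is nonnegative at all indices \<open>i \<ge> max {0, -n}\<close> of the system.\<close>

definition Ext_hat ::
  "('o, 'm) precat \<Rightarrow> 'o set \<Rightarrow> ('o \<Rightarrow> ('o, 'm) syzygy_resolution) \<Rightarrow> int \<Rightarrow> 'o \<Rightarrow> 'o
    \<Rightarrow> (nat \<times> 'm set) set monoid" where
  "Ext_hat A W res n M N =
     seq_colim (nat (max 0 (- n)))
       (\<lambda>i. stable_hom A W (Omega A (res M) (nat (int i + n))) (Omega A (res N) i))
       (\<lambda>i. Lambda A W (syzygy_seq A (res M) (nat (int i + n))) (syzygy_seq A (res N) i))"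

end

theory Submission
  imports Defs
begin

text \<open>Pulling back the special precover of \<open>N\<close> along \<open>f : M \<rightarrow> N\<close> and pushing out that of \<open>M\<close> along
  \<open>g : \<Omega>M \<rightarrow> \<Omega>N\<close> give the same class whenever \<open>g\<close> and \<open>f\<close> are the ends of a map of short exact
  sequences; hence \<open>\<Lambda>\<close> sends the class of \<open>f\<close> to the class of any such \<open>g\<close>.

  (iii) to (i): the class of the identity of \<open>M\<close> is mapped to that of the identity of \<open>\<Omega>\<^sub>kM\<close>. If it vanishes
  for some \<open>k\<close>, then \<open>\<Omega>\<^sub>kM\<close> is a direct summand of an object of \<open>W\<close> and the resolution can be truncated.

  (i) to (ii): by a Schanuel argument, the identity of \<open>\<Omega>\<^sub>iM\<close> is, modulo morphisms factoring through
  \<open>W\<close>, a composite through the \<open>i\<close>-th syzygy of any other proper resolution. If that resolution is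
  finite, the latter syzygy vanishes for large \<open>i\<close>, so all groups of the direct system vanish eventually.\<close>

section \<open>Preadditive categories\<close>

text \<open>A finite proper resolution of \<open>M\<close> need not be special: its syzygies may lie
  outside \<open>right_perp A W\<close>, whereas \<open>Lambda\<close> is evaluated along special
  precovers. The comparison of syzygies is therefore run on the lifting property alone, isolated in
  \<open>precover\<close> and \<open>syzygies\<close>. Orthogonality enters through
  \<open>right_perp_lift\<close>, above all in the surjectivity of the connecting map that
  determines \<open>beta\<close>.

  Both \<open>delta_bar\<close> and \<open>beta\<close> are descriptions on sets of extensions, so
  \<open>Lambda\<close> is first turned into a rule on ladders, from the right end to the left end.
  The direct system is then controlled by exhibiting ladders: arbitrary ones for closure, the
  identity ladder and the zero ladder for the classes that (iii) identifies. This identification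
  happens at a finite stage; the stage is taken positive so that truncating there leaves the
  augmentation untouched.

  Arguments with elements are replaced by pulling an epic back along a test morphism and cancelling
  the epic so obtained.\<close>

context category
begin

abbreviation plus (infixl "\<boxplus>" 65) where "f \<boxplus> g \<equiv> plus_mor A f g"

lemma HomD:
  assumes "f \<in> Hom A X Y"
  shows "f \<in> arr A" "src A f = X" "tgt A f = Y" "X \<in> obj A" "Y \<in> obj A"
  using assms src_obj tgt_obj by (auto simp: Hom_def)

lemma idt_arr [simp]:
  assumes "X \<in> obj A"
  shows "idt A X \<in> arr A" "src A (idt A X) = X" "tgt A (idt A X) = X"
  using idt_Hom[OF assms] by (auto simp: Hom_def)

lemma comp_idt_arr [simp]: "f \<in> arr A \<Longrightarrow> src A f = X \<Longrightarrow> f \<cdot> idt A X = f"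
  using comp_idt[of f X "tgt A f"] by (simp add: Hom_def)

lemma idt_comp_arr [simp]: "f \<in> arr A \<Longrightarrow> tgt A f = Y \<Longrightarrow> idt A Y \<cdot> f = f"
  using idt_comp[of f "src A f" Y] by (simp add: Hom_def)

lemma monicD: "monic A f \<Longrightarrow> f \<in> Hom A X Y \<Longrightarrow> g \<in> Hom A V X \<Longrightarrow> h \<in> Hom A V X \<Longrightarrow> f \<cdot> g = f \<cdot> h \<Longrightarrow> g = h"
  unfolding monic_def Hom_def by auto

lemma epicD: "epic A f \<Longrightarrow> f \<in> Hom A X Y \<Longrightarrow> g \<in> Hom A Y V \<Longrightarrow> h \<in> Hom A Y V \<Longrightarrow> g \<cdot> f = h \<cdot> f \<Longrightarrow> g = h"
  unfolding epic_def Hom_def by auto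

end

context preadditive_category
begin

lemma zero_Hom: "X \<in> obj A \<Longrightarrow> Y \<in> obj A \<Longrightarrow> zero_mor A X Y \<in> Hom A X Y"
  using group.is_monoid[OF comm_group.axioms(2)[OF hom_group], of X Y] monoid.one_closed
  by (fastforce simp: hom_group_def)

lemma plus_Hom:
  assumes "f \<in> Hom A X Y" "g \<in> Hom A X Y"
  shows "f \<boxplus> g \<in> Hom A X Y"
proof -
  interpret G: comm_group "hom_group A X Y" using HomD assms by (intro hom_group) auto
  show ?thesis using G.m_closed[of f g] assms by (simp add: hom_group_def)
qed

lemma plus_commute:
  assumes "f \<in> Hom A X Y" "g \<in> Hom A X Y"
  shows "f \<boxplus> g = g \<boxplus> f"
proof -
  interpret G: comm_group "hom_group A X Y" using HomD assms by (intro hom_group) auto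
  show ?thesis using G.m_comm[of f g] assms by (simp add: hom_group_def)
qed

lemma zero_plus:
  assumes "f \<in> Hom A X Y"
  shows "zero_mor A X Y \<boxplus> f = f" "f \<boxplus> zero_mor A X Y = f"
proof -
  interpret G: comm_group "hom_group A X Y" using HomD assms by (intro hom_group) auto
  show "zero_mor A X Y \<boxplus> f = f" "f \<boxplus> zero_mor A X Y = f"
    using G.l_one[of f] G.r_one[of f] assms by (simp_all add: hom_group_def)
qed

text \<open>Differences are mostly handled through this existence statement: bilinearity of
  composition then applies directly to the sum \<open>d \<boxplus> g\<close>.\<close>

lemma ex_minus:
  assumes "f \<in> Hom A X Y" "g \<in> Hom A X Y"
  shows "\<exists>d\<in>Hom A X Y. f = d \<boxplus> g"
proof -
  interpret G: comm_group "hom_group A X Y" using HomD assms by (intro hom_group) auto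
  let ?d = "f \<otimes>\<^bsub>hom_group A X Y\<^esub> inv\<^bsub>hom_group A X Y\<^esub> g"
  have fg: "f \<in> carrier (hom_group A X Y)" "g \<in> carrier (hom_group A X Y)"
    using assms by (auto simp: hom_group_def)
  have "?d \<in> carrier (hom_group A X Y)" "?d \<otimes>\<^bsub>hom_group A X Y\<^esub> g = f"
    using fg by (auto simp: G.m_assoc)
  then show ?thesis
    by (intro bexI[of _ ?d]) (simp_all add: hom_group_def)
qed

lemma plus_right_cancel:
  assumes "f \<in> Hom A X Y" "g \<in> Hom A X Y" "h \<in> Hom A X Y"
  shows "f \<boxplus> h = g \<boxplus> h \<longleftrightarrow> f = g"
proof -
  interpret G: comm_group "hom_group A X Y" using HomD assms by (intro hom_group) auto
  show ?thesis using G.right_cancel[of h f g] assms by (simp add: hom_group_def)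
qed

text \<open>Composition is only assumed additive; composites with a zero morphism are recognised as
  zero because adding them to themselves changes nothing.\<close>

lemma plus_self_eq:
  assumes "f \<in> Hom A X Y" "f \<boxplus> f = f"
  shows "f = zero_mor A X Y"
  by (metis HomD(4,5) assms plus_right_cancel zero_Hom zero_plus(1))

lemma comp_zero:
  assumes "g \<in> Hom A Y Z" "X \<in> obj A"
  shows "g \<cdot> zero_mor A X Y = zero_mor A X Z"
proof -
  have z: "zero_mor A X Y \<in> Hom A X Y" using assms HomD zero_Hom by blast
  show ?thesis
    using plus_self_eq[OF comp_Hom[OF z assms(1)]] comp_plus[OF z z assms(1)] zero_plus[OF z] by simp
qed

lemma zero_comp:
  assumes "f \<in> Hom A X Y" "Z \<in> obj A"
  shows "zero_mor A Y Z \<cdot> f = zero_mor A X Z"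
proof -
  have z: "zero_mor A Y Z \<in> Hom A Y Z" using assms HomD zero_Hom by blast
  show ?thesis
    using plus_self_eq[OF comp_Hom[OF assms(1) z]] plus_comp[OF assms(1) z z] zero_plus[OF z] by simp
qed

lemma monicI:
  assumes f: "f \<in> Hom A X Y"
    and z: "\<And>V h. h \<in> Hom A V X \<Longrightarrow> f \<cdot> h = zero_mor A V Y \<Longrightarrow> h = zero_mor A V X"
  shows "monic A f"
  unfolding monic_def
proof (intro conjI allI ballI impI)
  show "f \<in> arr A" using HomD(1)[OF f] .
  fix V g h assume g: "g \<in> Hom A V (src A f)" and h: "h \<in> Hom A V (src A f)" and eq: "f \<cdot> g = f \<cdot> h"
  then have gh: "g \<in> Hom A V X" "h \<in> Hom A V X" using HomD(2)[OF f] by auto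
  obtain d where d: "d \<in> Hom A V X" "g = d \<boxplus> h" using ex_minus gh by blast
  have "(f \<cdot> d) \<boxplus> (f \<cdot> h) = zero_mor A V Y \<boxplus> (f \<cdot> h)"
    using eq comp_plus[OF d(1) gh(2) f] d(2) zero_plus[OF comp_Hom[OF gh(2) f]] by simp
  then have "f \<cdot> d = zero_mor A V Y"
    using plus_right_cancel comp_Hom[OF _ f] d gh zero_Hom HomD f by metis
  then show "g = h" using z d zero_plus[OF gh(2)] by metis
qed

lemma monic_zeroD:
  assumes "monic A f" "f \<in> Hom A X Y" "h \<in> Hom A V X" "f \<cdot> h = zero_mor A V Y"
  shows "h = zero_mor A V X"
  using monicD[OF assms(1-3) zero_Hom] assms comp_zero HomD by metis

lemma is_kernelI:
  assumes f: "f \<in> Hom A X Y" and k: "k \<in> Hom A K X" and fk: "f \<cdot> k = zero_mor A K Y" and m: "monic A k"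
    and ex: "\<And>V h. h \<in> Hom A V X \<Longrightarrow> f \<cdot> h = zero_mor A V Y \<Longrightarrow> \<exists>u\<in>Hom A V K. k \<cdot> u = h"
  shows "is_kernel A f k"
proof -
  have "\<exists>!u. u \<in> Hom A V K \<and> k \<cdot> u = h" if "h \<in> Hom A V X" "f \<cdot> h = zero_mor A V Y" for V h
    using ex[OF that] monicD[OF m k] by metis
  then show ?thesis
    unfolding is_kernel_def using HomD[OF f] HomD[OF k] fk by simp
qed

lemma kernelD:
  assumes "is_kernel A f k" "f \<in> Hom A X Y"
  shows "k \<in> Hom A (src A k) X" "f \<cdot> k = zero_mor A (src A k) Y"
  using assms by (auto simp: is_kernel_def Hom_def)

lemma kernel_factor:
  assumes "is_kernel A f k" "f \<in> Hom A X Y" "h \<in> Hom A V X" "f \<cdot> h = zero_mor A V Y"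
  shows "\<exists>u\<in>Hom A V (src A k). k \<cdot> u = h"
proof -
  have "\<exists>!u. u \<in> Hom A V (src A k) \<and> k \<cdot> u = h"
    using assms HomD[OF assms(2)] unfolding is_kernel_def by simp
  then show ?thesis by blast
qed

lemma kernel_monic:
  assumes "is_kernel A f k"
  shows "monic A k"
proof -
  obtain X Y where f: "f \<in> Hom A X Y" using assms by (auto simp: is_kernel_def Hom_def)
  note k = kernelD[OF assms f]
  show ?thesis unfolding monic_def
  proof (intro conjI allI ballI impI)
    show "k \<in> arr A" using HomD k by blast
    fix V g h assume g: "g \<in> Hom A V (src A k)" and h: "h \<in> Hom A V (src A k)" and eq: "k \<cdot> g = k \<cdot> h"
    have "f \<cdot> (k \<cdot> g) = zero_mor A V Y"
      using comp_assoc[OF g k(1) f] k(2) zero_comp[OF g] HomD(5)[OF f] by simp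
    moreover have "k \<cdot> g \<in> Hom A V X" using comp_Hom g k by blast
    ultimately have "\<exists>!u. u \<in> Hom A V (src A k) \<and> k \<cdot> u = k \<cdot> g"
      using assms HomD[OF f] unfolding is_kernel_def by blast
    then show "g = h" using g h eq by auto
  qed
qed

end

section \<open>Duality\<close>

text \<open>Facts about epics, cokernels and pushouts are obtained by instantiating their duals
  here. Objects, arrows, identities and addition are kept, so simplification turns a dualized
  statement back into one about \<open>A\<close>.\<close>

definition opposite :: "('o, 'm) precat \<Rightarrow> ('o, 'm) precat" where
  "opposite A = \<lparr>obj = obj A, arr = arr A, src = tgt A, tgt = src A, idt = idt A,
     comp_mor = (\<lambda>g f. f \<cdot>\<^bsub>A\<^esub> g), plus_mor = plus_mor A, zero_mor = (\<lambda>X Y. zero_mor A Y X)\<rparr>"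

lemma opposite_simps [simp]:
  "obj (opposite A) = obj A" "arr (opposite A) = arr A" "src (opposite A) = tgt A"
  "tgt (opposite A) = src A" "idt (opposite A) = idt A" "g \<cdot>\<^bsub>opposite A\<^esub> f = f \<cdot>\<^bsub>A\<^esub> g"
  "plus_mor (opposite A) = plus_mor A" "zero_mor (opposite A) X Y = zero_mor A Y X"
  by (simp_all add: opposite_def)

lemma Hom_opposite [simp]: "Hom (opposite A) X Y = Hom A Y X"
  by (auto simp: Hom_def)

lemma is_kernel_opposite [simp]: "is_kernel (opposite A) f k \<longleftrightarrow> is_cokernel A f k"
  by (auto simp: is_kernel_def is_cokernel_def)

lemma is_cokernel_opposite [simp]: "is_cokernel (opposite A) f k \<longleftrightarrow> is_kernel A f k"
  by (auto simp: is_kernel_def is_cokernel_def)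

lemma monic_opposite [simp]: "monic (opposite A) f \<longleftrightarrow> epic A f"
  by (auto simp: monic_def epic_def)

lemma epic_opposite [simp]: "epic (opposite A) f \<longleftrightarrow> monic A f"
  by (auto simp: monic_def epic_def)

lemma hom_group_opposite [simp]: "hom_group (opposite A) X Y = hom_group A Y X"
  by (simp add: hom_group_def)

lemma zero_object_opposite [simp]: "zero_object (opposite A) Z \<longleftrightarrow> zero_object A Z"
  by (auto simp: zero_object_def)

lemma is_direct_sum_opposite:
  assumes "is_direct_sum A X Y B"
  shows "is_direct_sum (opposite A) X Y B"
proof -
  obtain i1 i2 p1 p2 where "biproduct A X Y B i1 i2 p1 p2" using assms by (auto simp: is_direct_sum_def)
  then have "biproduct (opposite A) X Y B p1 p2 i1 i2" by (simp add: biproduct_def)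
  then show ?thesis by (auto simp: is_direct_sum_def)
qed

lemma preadditive_opposite:
  assumes "preadditive_category A"
  shows "preadditive_category (opposite A)"
proof -
  interpret preadditive_category A by fact
  show ?thesis
    by (intro preadditive_category.intro category.intro preadditive_category_axioms.intro)
      (auto intro: src_obj tgt_obj idt_Hom comp_Hom comp_idt idt_comp comp_assoc[symmetric]
        hom_group comp_plus plus_comp)
qed

lemma abelian_opposite:
  assumes "abelian_category A"
  shows "abelian_category (opposite A)"
proof -
  interpret abelian_category A by fact
  interpret D: preadditive_category "opposite A"
    by (rule preadditive_opposite) unfold_locales
  show ?thesis
  proof unfold_locales
    show "\<exists>Z. zero_object (opposite A) Z" using ex_zero_object by simp
    show "\<exists>B. is_direct_sum (opposite A) X Y B" if "X \<in> obj (opposite A)" "Y \<in> obj (opposite A)" for X Y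
      using that ex_direct_sum is_direct_sum_opposite by fastforce
  qed (auto intro: ex_kernel ex_cokernel monic_is_kernel epic_is_cokernel)
qed

context preadditive_category
begin

lemmas dual = preadditive_opposite[OF preadditive_category_axioms]

lemmas epicI = preadditive_category.monicI[OF dual, simplified]
lemmas epic_zeroD = preadditive_category.monic_zeroD[OF dual, simplified]
lemmas is_cokernelI = preadditive_category.is_kernelI[OF dual, simplified]
lemmas cokernelD = preadditive_category.kernelD[OF dual, simplified]
lemmas cokernel_factor = preadditive_category.kernel_factor[OF dual, simplified]
lemmas cokernel_epic = preadditive_category.kernel_monic[OF dual, simplified]

end

section \<open>Short exact sequences\<close>

context abelian_category
begin

lemmas abelian_dual = abelian_opposite[OF abelian_category_axioms]

text \<open>The axioms only give some \<open>f\<close> with kernel \<open>k\<close>. It factors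
  through the cokernel \<open>q\<close>, so whatever \<open>q\<close> kills is killed by
  \<open>f\<close> and hence factors through \<open>k\<close>.\<close>

lemma monic_kernel_of_cokernel:
  assumes m: "monic A k" and q: "is_cokernel A k q"
  shows "is_kernel A q k"
proof -
  obtain f where f: "is_kernel A f k" using monic_is_kernel[OF m] by blast
  have k: "k \<in> Hom A (src A k) (tgt A k)" using m by (simp add: monic_def Hom_def)
  have fH: "f \<in> Hom A (tgt A k) (tgt A f)" using f by (simp add: is_kernel_def Hom_def)
  have qH: "q \<in> Hom A (tgt A k) (tgt A q)" "q \<cdot> k = zero_mor A (src A k) (tgt A q)"
    using cokernelD[OF q k] .
  obtain w where w: "w \<in> Hom A (tgt A q) (tgt A f)" "w \<cdot> q = f"
    using cokernel_factor[OF q k fH] kernelD[OF f fH] by blast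
  show ?thesis
  proof (rule is_kernelI[OF qH(1) k qH(2) m])
    fix V h assume h: "h \<in> Hom A V (tgt A k)" and qh: "q \<cdot> h = zero_mor A V (tgt A q)"
    have "f \<cdot> h = w \<cdot> (q \<cdot> h)" using comp_assoc[OF h qH(1) w(1)] w(2) by simp
    also have "\<dots> = zero_mor A V (tgt A f)" using qh comp_zero[OF w(1)] HomD h by simp
    finally show "\<exists>u\<in>Hom A V (src A k). k \<cdot> u = h" using kernel_factor[OF f fH h] by blast
  qed
qed

lemmas epic_cokernel_of_kernel = abelian_category.monic_kernel_of_cokernel[OF abelian_dual, simplified]

text \<open>Two kernels of \<open>f\<close> factor through each other. This moves the anonymous
  image \<open>m\<close> in \<open>exact_at\<close> to the map at hand.\<close>

lemma kernel_unique:
  assumes k: "is_kernel A f k" and m: "is_kernel A f m" and g: "is_kernel A g m"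
  shows "is_kernel A g k"
proof -
  obtain X Y where f: "f \<in> Hom A X Y" using k by (auto simp: is_kernel_def Hom_def)
  note kH = kernelD[OF k f] and mH = kernelD[OF m f]
  obtain Z where gH: "g \<in> Hom A X Z" using g mH by (auto simp: is_kernel_def Hom_def)
  note gm = kernelD[OF g gH]
  obtain u where u: "u \<in> Hom A (src A k) (src A m)" "m \<cdot> u = k" using kernel_factor[OF m f kH] by blast
  obtain v where v: "v \<in> Hom A (src A m) (src A k)" "k \<cdot> v = m" using kernel_factor[OF k f mH] by blast
  show ?thesis
  proof (rule is_kernelI[OF gH kH(1) _ kernel_monic[OF k]])
    have "g \<cdot> k = (g \<cdot> m) \<cdot> u" using comp_assoc[OF u(1) gm(1) gH] u(2) by simp
    then show "g \<cdot> k = zero_mor A (src A k) Z" using gm(2) zero_comp[OF u(1)] HomD(5)[OF gH] by simp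
    fix V h assume h: "h \<in> Hom A V X" "g \<cdot> h = zero_mor A V Z"
    then obtain t where t: "t \<in> Hom A V (src A m)" "m \<cdot> t = h" using kernel_factor[OF g gH] by blast
    have "k \<cdot> (v \<cdot> t) = h" using comp_assoc[OF t(1) v(1) kH(1)] v(2) t(2) by simp
    then show "\<exists>u\<in>Hom A V (src A k). k \<cdot> u = h" using comp_Hom[OF t(1) v(1)] by blast
  qed
qed

text \<open>A monic is its own image, being the kernel of its cokernel. The right-hand side is
  self-dual, which makes short exactness dualize at once.\<close>

lemma short_exact_iff: "short_exact A i p \<longleftrightarrow> is_kernel A p i \<and> is_cokernel A i p"
proof
  assume se: "short_exact A i p"
  then obtain m q where mq: "is_cokernel A i q" "is_kernel A q m" "is_kernel A p m" and i: "monic A i" and p: "epic A p"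
    by (auto simp: short_exact_def exact_at_def is_image_def)
  have "is_kernel A p i" using kernel_unique[OF monic_kernel_of_cokernel[OF i mq(1)] mq(2,3)] .
  then show "is_kernel A p i \<and> is_cokernel A i p" using epic_cokernel_of_kernel[OF p] by blast
next
  assume "is_kernel A p i \<and> is_cokernel A i p"
  then show "short_exact A i p"
    using kernel_monic cokernel_epic by (auto simp: short_exact_def exact_at_def is_image_def)
qed

lemma short_exact_opposite: "short_exact (opposite A) p i \<longleftrightarrow> short_exact A i p"
  using short_exact_iff abelian_category.short_exact_iff[OF abelian_dual] by auto

lemma short_exactD:
  assumes "short_exact A i p"
  shows "i \<in> Hom A (src A i) (src A p)" "p \<in> Hom A (src A p) (tgt A p)"
    "p \<cdot> i = zero_mor A (src A i) (tgt A p)" "monic A i" "epic A p" "tgt A i = src A p"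
    "is_kernel A p i" "is_cokernel A i p"
  using assms short_exact_iff[of i p] by (auto simp: is_kernel_def Hom_def short_exact_def)

text \<open>A monic \<open>b\<close> is the kernel of some \<open>f\<close>; if \<open>b\<close> is
  also epic, then \<open>f = 0\<close>, so the identity of \<open>Y\<close> factors through
  \<open>b\<close>.\<close>

lemma monic_epic_iso:
  assumes m: "monic A b" and e: "epic A b" and b: "b \<in> Hom A X Y"
  shows "\<exists>c\<in>Hom A Y X. c \<cdot> b = idt A X \<and> b \<cdot> c = idt A Y"
proof -
  note X = HomD(4)[OF b] and Y = HomD(5)[OF b]
  obtain f where f: "is_kernel A f b" using monic_is_kernel[OF m] by blast
  have fH: "f \<in> Hom A Y (tgt A f)" using f b by (auto simp: is_kernel_def Hom_def)
  have srcb: "src A b = X" using b by (simp add: Hom_def)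
  have f0: "f = zero_mor A Y (tgt A f)"
    using epic_zeroD[OF e b fH] kernelD(2)[OF f fH] srcb by simp
  have "f \<cdot> idt A Y = zero_mor A Y (tgt A f)" using f0 comp_idt[OF fH] by simp
  then obtain c where c: "c \<in> Hom A Y X" "b \<cdot> c = idt A Y"
    using kernel_factor[OF f fH idt_Hom[OF Y]] srcb by auto
  have "b \<cdot> (c \<cdot> b) = b \<cdot> idt A X"
    using comp_assoc[OF b c(1) b] c(2) idt_comp[OF b] comp_idt[OF b] by simp
  then have "c \<cdot> b = idt A X" using monicD[OF m b comp_Hom[OF b c(1)] idt_Hom[OF X]] by simp
  then show ?thesis using c by blast
qed

text \<open>\<open>ladder\<close> reads the middle term as the target of the first map; after
  reversal it is the source of the second. Short exactness makes the two agree.\<close>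

lemma ladder_opposite:
  assumes "short_exact A i p" "short_exact A i' p'"
  shows "ladder (opposite A) (p', i') (p, i) c b a \<longleftrightarrow> ladder A (i, p) (i', p') a b c"
  using short_exactD(6)[OF assms(1)] short_exactD(6)[OF assms(2)]
  by (auto simp: ladder_def)

lemma extensions_opposite:
  "(p, i) \<in> extensions (opposite A) N M \<longleftrightarrow> (i, p) \<in> extensions A M N"
  by (auto simp: extensions_def short_exact_opposite)

section \<open>Maps of short exact sequences, pullbacks and pushouts\<close>

lemma ladderD:
  assumes "ladder A (i, p) (i', p') a b c" "short_exact A i p" "short_exact A i' p'"
  shows "a \<in> Hom A (src A i) (src A i')" "b \<in> Hom A (src A p) (src A p')" "c \<in> Hom A (tgt A p) (tgt A p')"
    "b \<cdot> i = i' \<cdot> a" "c \<cdot> p = p' \<cdot> b"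
  using assms(1) short_exactD(6)[OF assms(2)] short_exactD(6)[OF assms(3)] by (auto simp: ladder_def)

lemma ladderI:
  assumes "short_exact A i p" "short_exact A i' p'"
    "a \<in> Hom A (src A i) (src A i')" "b \<in> Hom A (src A p) (src A p')" "c \<in> Hom A (tgt A p) (tgt A p')"
    "b \<cdot> i = i' \<cdot> a" "c \<cdot> p = p' \<cdot> b"
  shows "ladder A (i, p) (i', p') a b c"
  using assms short_exactD(6)[OF assms(1)] short_exactD(6)[OF assms(2)] by (auto simp: ladder_def)

lemma ladder_comp:
  assumes "ladder A \<xi> \<eta> a b c" "ladder A \<eta> \<zeta> a' b' c'"
    "short_exact A (fst \<xi>) (snd \<xi>)" "short_exact A (fst \<eta>) (snd \<eta>)" "short_exact A (fst \<zeta>) (snd \<zeta>)"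
  shows "ladder A \<xi> \<zeta> (a' \<cdot> a) (b' \<cdot> b) (c' \<cdot> c)"
proof -
  obtain i p j q k r where e: "\<xi> = (i, p)" "\<eta> = (j, q)" "\<zeta> = (k, r)" by (cases \<xi>, cases \<eta>, cases \<zeta>)
  note S = assms(3-5)[unfolded e fst_conv snd_conv]
  note x = ladderD[OF assms(1)[unfolded e] S(1,2)] and y = ladderD[OF assms(2)[unfolded e] S(2,3)]
  note h = short_exactD(1,2)[OF S(1)] short_exactD(1,2)[OF S(2)] short_exactD(1,2)[OF S(3)]
  show ?thesis unfolding e
  proof (rule ladderI[OF S(1,3)])
    show "(b' \<cdot> b) \<cdot> i = k \<cdot> (a' \<cdot> a)"
      using x y h comp_assoc[OF h(1) x(2) y(2)] comp_assoc[OF x(1) h(3) y(2)] comp_assoc[OF x(1) y(1) h(5)]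
      by simp
    show "(c' \<cdot> c) \<cdot> p = r \<cdot> (b' \<cdot> b)"
      using x y h comp_assoc[OF h(2) x(3) y(3)] comp_assoc[OF x(2) h(4) y(3)] comp_assoc[OF x(2) y(2) h(6)]
      by simp
  qed (use x y comp_Hom in blast)+
qed

text \<open>The pullback is the kernel of \<open>q \<pi>\<^sub>1 - f \<pi>\<^sub>2 : E \<oplus> M \<rightarrow> N\<close>; its projection to \<open>M\<close> is epic because
  \<open>q\<close> is and this map is therefore the cokernel of its kernel.\<close>

lemma ex_pullback:
  assumes se: "short_exact A i q" and f: "f \<in> Hom A M (tgt A q)"
  shows "\<exists>i' p'. (i', p') \<in> extensions A M (src A i) \<and> (\<exists>b. ladder A (i', p') (i, q) (idt A (src A i)) b f) \<and>
    (\<forall>j p a b. short_exact A j p \<longrightarrow> tgt A p = M \<longrightarrow> ladder A (j, p) (i, q) a b f \<longrightarrow>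
      (\<exists>u. ladder A (j, p) (i', p') a u (idt A M)))"
proof -
  let ?K = "src A i" and ?E = "src A q" and ?N = "tgt A q"
  note i = short_exactD(1)[OF se] and q = short_exactD(2)[OF se] and qi = short_exactD(3)[OF se]
  note M = HomD(4)[OF f] and K = HomD(4)[OF i] and E = HomD(4)[OF q] and N = HomD(5)[OF q]
  obtain B i1 i2 p1 p2 where "biproduct A ?E M B i1 i2 p1 p2"
    using ex_direct_sum[OF E M] by (auto simp: is_direct_sum_def)
  then have i1: "i1 \<in> Hom A ?E B" and i2: "i2 \<in> Hom A M B" and p1: "p1 \<in> Hom A B ?E" and p2: "p2 \<in> Hom A B M"
    and pi: "p1 \<cdot> i1 = idt A ?E" "p2 \<cdot> i2 = idt A M" "p1 \<cdot> i2 = zero_mor A M ?E" "p2 \<cdot> i1 = zero_mor A ?E M"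
    and ip: "(i1 \<cdot> p1) \<boxplus> (i2 \<cdot> p2) = idt A B" by (auto simp: biproduct_def)
  note B = HomD(5)[OF i1]
  have qp1: "q \<cdot> p1 \<in> Hom A B ?N" and fp2: "f \<cdot> p2 \<in> Hom A B ?N"
    using comp_Hom p1 q p2 f by blast+
  obtain d where d: "d \<in> Hom A B ?N" and deq: "q \<cdot> p1 = d \<boxplus> (f \<cdot> p2)" using ex_minus[OF qp1 fp2] by blast
  have dx: "d \<cdot> x = zero_mor A V ?N \<longleftrightarrow> q \<cdot> (p1 \<cdot> x) = f \<cdot> (p2 \<cdot> x)" if x: "x \<in> Hom A V B" for V x
  proof -
    have 1: "d \<cdot> x \<in> Hom A V ?N" and 2: "(f \<cdot> p2) \<cdot> x \<in> Hom A V ?N"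
      using comp_Hom x d fp2 by blast+
    have "q \<cdot> (p1 \<cdot> x) = (d \<cdot> x) \<boxplus> (f \<cdot> (p2 \<cdot> x))"
      using comp_assoc[OF x p1 q] comp_assoc[OF x p2 f] plus_comp[OF x d fp2] deq by simp
    then show ?thesis
      using plus_right_cancel[OF 1 zero_Hom 2] zero_plus[OF 2] comp_assoc[OF x p2 f] HomD[OF 1] by simp
  qed
  have joint: "x = y" if x: "x \<in> Hom A V B" and y: "y \<in> Hom A V B" and e: "p1 \<cdot> x = p1 \<cdot> y" "p2 \<cdot> x = p2 \<cdot> y" for V x y
  proof -
    have r: "z = (i1 \<cdot> (p1 \<cdot> z)) \<boxplus> (i2 \<cdot> (p2 \<cdot> z))" if z: "z \<in> Hom A V B" for z
      using idt_comp[OF z] plus_comp[OF z comp_Hom[OF p1 i1] comp_Hom[OF p2 i2]]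
        comp_assoc[OF z p1 i1] comp_assoc[OF z p2 i2] ip by simp
    show ?thesis using r[OF x] r[OF y] e by simp
  qed
  have pair: "\<exists>z\<in>Hom A V B. p1 \<cdot> z = x \<and> p2 \<cdot> z = y" if x: "x \<in> Hom A V ?E" and y: "y \<in> Hom A V M" for V x y
  proof -
    have z: "i1 \<cdot> x \<in> Hom A V B" "i2 \<cdot> y \<in> Hom A V B" using x y i1 i2 comp_Hom by blast+
    have "p1 \<cdot> ((i1 \<cdot> x) \<boxplus> (i2 \<cdot> y)) = x"
      using comp_plus[OF z p1] comp_assoc[OF x i1 p1] comp_assoc[OF y i2 p1] pi idt_comp[OF x]
        zero_comp[OF y E] zero_plus[OF x] by simp
    moreover have "p2 \<cdot> ((i1 \<cdot> x) \<boxplus> (i2 \<cdot> y)) = y"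
      using comp_plus[OF z p2] comp_assoc[OF x i1 p2] comp_assoc[OF y i2 p2] pi idt_comp[OF y]
        zero_comp[OF x M] zero_plus[OF y] by simp
    ultimately show ?thesis using plus_Hom[OF z] by blast
  qed
  obtain e where e: "is_kernel A d e" using ex_kernel[OF HomD(1)[OF d]] by blast
  define F where "F = src A e"
  have eH: "e \<in> Hom A F B" "d \<cdot> e = zero_mor A F ?N" using kernelD[OF e d] by (simp_all add: F_def)
  note F = HomD(4)[OF eH(1)]
  have em: "monic A e" using kernel_monic[OF e] .
  have di1: "d \<cdot> i1 = q"
  proof -
    have "(d \<cdot> i1) \<boxplus> ((f \<cdot> p2) \<cdot> i1) = (q \<cdot> p1) \<cdot> i1" using plus_comp[OF i1 d fp2] deq by simp
    moreover have "(q \<cdot> p1) \<cdot> i1 = q" using comp_assoc[OF i1 p1 q] pi comp_idt[OF q] by simp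
    moreover have "(f \<cdot> p2) \<cdot> i1 = zero_mor A ?E ?N" using comp_assoc[OF i1 p2 f] pi comp_zero[OF f E] by simp
    ultimately show ?thesis using zero_plus[OF comp_Hom[OF i1 d]] by simp
  qed
  have "epic A d"
  proof (rule epicI[OF d])
    fix V h assume h: "h \<in> Hom A ?N V" "h \<cdot> d = zero_mor A B V"
    have "h \<cdot> q = zero_mor A ?E V"
      using comp_assoc[OF i1 d h(1)] h(2) zero_comp[OF i1] HomD(5)[OF h(1)] di1 by simp
    then show "h = zero_mor A ?N V" using epic_zeroD[OF short_exactD(5)[OF se] q h(1)] by simp
  qed
  then have dc: "is_cokernel A e d" using epic_cokernel_of_kernel e by blast
  define b where "b = p1 \<cdot> e"
  define p' where "p' = p2 \<cdot> e"
  have b: "b \<in> Hom A F ?E" and p': "p' \<in> Hom A F M" using comp_Hom eH p1 p2 by (auto simp: b_def p'_def)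
  have comm: "q \<cdot> b = f \<cdot> p'" using dx[OF eH(1)] eH(2) by (simp add: b_def p'_def)
  have univ: "\<exists>u\<in>Hom A V F. b \<cdot> u = x \<and> p' \<cdot> u = y"
    if x: "x \<in> Hom A V ?E" and y: "y \<in> Hom A V M" and xy: "q \<cdot> x = f \<cdot> y" for V x y
  proof -
    obtain z where z: "z \<in> Hom A V B" "p1 \<cdot> z = x" "p2 \<cdot> z = y" using pair[OF x y] by blast
    have "d \<cdot> z = zero_mor A V ?N" using dx[OF z(1)] xy z by simp
    then obtain u where u: "u \<in> Hom A V F" "e \<cdot> u = z" using kernel_factor[OF e d z(1)] F_def by blast
    then show ?thesis
      using z comp_assoc[OF u(1) eH(1) p1] comp_assoc[OF u(1) eH(1) p2] by (auto simp: b_def p'_def)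
  qed
  have uniq: "x = y" if x: "x \<in> Hom A V F" and y: "y \<in> Hom A V F" and xy: "b \<cdot> x = b \<cdot> y" "p' \<cdot> x = p' \<cdot> y" for V x y
  proof -
    have "e \<cdot> x = e \<cdot> y"
      using joint[OF comp_Hom[OF x eH(1)] comp_Hom[OF y eH(1)]] xy
        comp_assoc[OF x eH(1) p1] comp_assoc[OF x eH(1) p2] comp_assoc[OF y eH(1) p1] comp_assoc[OF y eH(1) p2]
      by (simp add: b_def p'_def)
    then show ?thesis using monicD[OF em eH(1) x y] by simp
  qed
  have "epic A p'"
  proof (rule epicI[OF p'])
    fix V h assume h: "h \<in> Hom A M V" "h \<cdot> p' = zero_mor A F V"
    note V = HomD(5)[OF h(1)]
    \<comment> \<open>Since \<open>h \<cdot> p2\<close> vanishes on the kernel \<open>e\<close> of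
      \<open>d\<close>, it factors as \<open>w \<cdot> d\<close>. Restriction to the first summand
      gives \<open>w \<cdot> q = 0\<close>, so \<open>w\<close> vanishes, and with it
      \<open>h\<close>.\<close>
    have hp2: "h \<cdot> p2 \<in> Hom A B V" using comp_Hom p2 h by blast
    have "(h \<cdot> p2) \<cdot> e = zero_mor A F V" using comp_assoc[OF eH(1) p2 h(1)] h(2) by (simp add: p'_def)
    then obtain w where w: "w \<in> Hom A ?N V" "w \<cdot> d = h \<cdot> p2"
      using cokernel_factor[OF dc eH(1) hp2] HomD(3)[OF d] by auto
    have "w \<cdot> q = (h \<cdot> p2) \<cdot> i1" using comp_assoc[OF i1 d w(1)] w(2) di1 by simp
    also have "\<dots> = zero_mor A ?E V" using comp_assoc[OF i1 p2 h(1)] pi comp_zero[OF h(1) E] by simp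
    finally have "w = zero_mor A ?N V" using epic_zeroD[OF short_exactD(5)[OF se] q w(1)] by simp
    then have "h \<cdot> p2 = zero_mor A B V" using w(2) zero_comp[OF d V] by simp
    then have "(h \<cdot> p2) \<cdot> i2 = zero_mor A M V" using zero_comp[OF i2 V] by simp
    then show "h = zero_mor A M V" using comp_assoc[OF i2 p2 h(1)] pi comp_idt[OF h(1)] by simp
  qed
  obtain i' where i': "i' \<in> Hom A ?K F" "b \<cdot> i' = i" "p' \<cdot> i' = zero_mor A ?K M"
    using univ[OF i zero_Hom[OF K M]] qi comp_zero[OF f K] by auto
  have im: "monic A i'"
  proof (rule monicI[OF i'(1)])
    fix V h assume h: "h \<in> Hom A V ?K" "i' \<cdot> h = zero_mor A V F"
    then have "i \<cdot> h = zero_mor A V ?E"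
      using comp_assoc[OF h(1) i'(1) b] i'(2) comp_zero[OF b] HomD(4)[OF h(1)] by simp
    then show "h = zero_mor A V ?K" using monic_zeroD[OF short_exactD(4)[OF se] i h(1)] by simp
  qed
  have ker: "is_kernel A p' i'"
  proof (rule is_kernelI[OF p' i'(1,3) im])
    fix V h assume h: "h \<in> Hom A V F" "p' \<cdot> h = zero_mor A V M"
    note V = HomD(4)[OF h(1)]
    have bh: "b \<cdot> h \<in> Hom A V ?E" using comp_Hom h b by blast
    have "q \<cdot> (b \<cdot> h) = zero_mor A V ?N"
      using comp_assoc[OF h(1) b q] comm comp_assoc[OF h(1) p' f] h(2) comp_zero[OF f V] by simp
    then obtain u where u: "u \<in> Hom A V ?K" "i \<cdot> u = b \<cdot> h"
      using kernel_factor[OF short_exactD(7)[OF se] q bh] by blast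
    have "i' \<cdot> u = h"
      using uniq[OF comp_Hom[OF u(1) i'(1)] h(1)] comp_assoc[OF u(1) i'(1) b] comp_assoc[OF u(1) i'(1) p']
        i' u h(2) zero_comp[OF u(1) M] by simp
    then show "\<exists>u\<in>Hom A V ?K. i' \<cdot> u = h" using u by blast
  qed
  have se': "short_exact A i' p'"
    using short_exact_iff ker epic_cokernel_of_kernel[OF \<open>epic A p'\<close> ker] by blast
  have s: "src A i' = ?K" "src A p' = F" "tgt A p' = M" using i' p' by (auto simp: Hom_def)
  have 1: "(i', p') \<in> extensions A M ?K" using se' s by (simp add: extensions_def)
  have 2: "ladder A (i', p') (i, q) (idt A ?K) b f"
    by (rule ladderI[OF se' se]) (use s b f idt_Hom[OF K] i' comp_idt[OF i] comm in simp_all)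
  \<comment> \<open>The left end \<open>a\<close> is arbitrary here; this is what later turns a
    ladder over \<open>f\<close> into one exhibiting the pullback as a pushout.\<close>
  have 3: "\<exists>u. ladder A (j, p) (i', p') a u (idt A M)"
    if sj: "short_exact A j p" "tgt A p = M" and l: "ladder A (j, p) (i, q) a c f" for j p a c
  proof -
    note x = ladderD[OF l sj(1) se] and j = short_exactD(1)[OF sj(1)] and p = short_exactD(2)[OF sj(1)]
    obtain u where u: "u \<in> Hom A (src A p) F" "b \<cdot> u = c" "p' \<cdot> u = p"
      using univ[of c "src A p" p] x p sj(2) by auto
    have "u \<cdot> j = i' \<cdot> a"
    proof (rule uniq[OF comp_Hom[OF j u(1)] comp_Hom[OF x(1) i'(1)]])
      show "b \<cdot> (u \<cdot> j) = b \<cdot> (i' \<cdot> a)"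
        using comp_assoc[OF j u(1) b] comp_assoc[OF x(1) i'(1) b] u i' x(4) by simp
      show "p' \<cdot> (u \<cdot> j) = p' \<cdot> (i' \<cdot> a)"
        using comp_assoc[OF j u(1) p'] comp_assoc[OF x(1) i'(1) p'] u i' short_exactD(3)[OF sj(1)]
          zero_comp[OF x(1) M] sj(2) by simp
    qed
    then have "ladder A (j, p) (i', p') a u (idt A M)"
      by (intro ladderI[OF sj(1) se']) (use s x u sj idt_Hom[OF M] p idt_comp in auto)
    then show ?thesis by blast
  qed
  show ?thesis using 1 2 3 by blast
qed

lemma ex_pushout:
  assumes se: "short_exact A j p" and g: "g \<in> Hom A (src A j) N"
  shows "\<exists>i' p'. (i', p') \<in> extensions A (tgt A p) N \<and> (\<exists>b. ladder A (j, p) (i', p') g b (idt A (tgt A p))) \<and>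
    (\<forall>i q c b. short_exact A i q \<longrightarrow> src A i = N \<longrightarrow> ladder A (j, p) (i, q) g b c \<longrightarrow>
      (\<exists>u. ladder A (i', p') (i, q) (idt A N) u c))"
proof -
  interpret D: abelian_category "opposite A" by (rule abelian_dual)
  obtain p' i' where E: "(p', i') \<in> extensions (opposite A) N (src (opposite A) p)"
    and l: "\<exists>b. ladder (opposite A) (p', i') (p, j) (idt (opposite A) (src (opposite A) p)) b g"
    and u: "\<forall>q i c b. short_exact (opposite A) q i \<longrightarrow> tgt (opposite A) i = N \<longrightarrow>
      ladder (opposite A) (q, i) (p, j) c b g \<longrightarrow> (\<exists>u. ladder (opposite A) (q, i) (p', i') c u (idt (opposite A) N))"
    using D.ex_pullback[of p j g N] se g by (auto simp: short_exact_opposite)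
  have E': "(i', p') \<in> extensions A (tgt A p) N" using E by (simp add: extensions_opposite)
  then have se': "short_exact A i' p'" by (simp add: extensions_def)
  show ?thesis
  proof (rule exI[of _ i'], rule exI[of _ p'], intro conjI allI impI)
    show "(i', p') \<in> extensions A (tgt A p) N" by fact
    show "\<exists>b. ladder A (j, p) (i', p') g b (idt A (tgt A p))"
      using l ladder_opposite[OF se se'] by simp
    show "\<exists>u. ladder A (i', p') (i, q) (idt A N) u c"
      if h: "short_exact A i q" "src A i = N" "ladder A (j, p) (i, q) g b c" for i q c b
      using h u[rule_format, of q i c b] ladder_opposite[OF se h(1)] ladder_opposite[OF se' h(1)]
      by (simp add: short_exact_opposite)
  qed
qed

end

section \<open>Extension classes\<close>

context abelian_category
begin

text \<open>The short five lemma: between identity ends the middle map is monic and epic, hence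
  invertible, and its inverse gives the reverse ladder.\<close>

lemma extension_rel_sym:
  assumes "(\<xi>, \<eta>) \<in> extension_rel A M N"
  shows "(\<eta>, \<xi>) \<in> extension_rel A M N"
proof -
  obtain i p i' p' where e: "\<xi> = (i, p)" "\<eta> = (i', p')" by (cases \<xi>, cases \<eta>)
  obtain b where ext: "(i, p) \<in> extensions A M N" "(i', p') \<in> extensions A M N"
    and l: "ladder A (i, p) (i', p') (idt A N) b (idt A M)"
    using assms e by (auto simp: extension_rel_def)
  then have se: "short_exact A i p" "short_exact A i' p'" and
    s: "src A i = N" "tgt A p = M" "src A i' = N" "tgt A p' = M" by (auto simp: extensions_def)
  note i = short_exactD(1)[OF se(1), unfolded s] and p = short_exactD(2)[OF se(1), unfolded s]
    and i' = short_exactD(1)[OF se(2), unfolded s] and p' = short_exactD(2)[OF se(2), unfolded s]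
  note N = HomD(4)[OF i] and M = HomD(5)[OF p]
  note x = ladderD[OF l se]
  have bi: "b \<cdot> i = i'" and pb: "p' \<cdot> b = p" using x comp_idt[OF i'] idt_comp[OF p] by simp_all
  have "monic A b"
  proof (rule monicI[OF x(2)])
    fix V h assume h: "h \<in> Hom A V (src A p)" "b \<cdot> h = zero_mor A V (src A p')"
    have "p \<cdot> h = zero_mor A V M"
      using comp_assoc[OF h(1) x(2) p'] pb h(2) comp_zero[OF p'] HomD(4)[OF h(1)] by simp
    then obtain u where u: "u \<in> Hom A V N" "i \<cdot> u = h"
      using kernel_factor[OF short_exactD(7)[OF se(1)] p h(1)] s by auto
    have "i' \<cdot> u = zero_mor A V (src A p')"
      using comp_assoc[OF u(1) i x(2)] bi u(2) h(2) by simp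
    then have "u = zero_mor A V N" using monic_zeroD[OF short_exactD(4)[OF se(2)] i' u(1)] by simp
    then show "h = zero_mor A V (src A p)" using u comp_zero[OF i] HomD(4)[OF u(1)] by simp
  qed
  moreover have "epic A b"
  proof (rule epicI[OF x(2)])
    fix V h assume h: "h \<in> Hom A (src A p') V" "h \<cdot> b = zero_mor A (src A p) V"
    have "h \<cdot> i' = zero_mor A N V"
      using comp_assoc[OF i x(2) h(1)] bi h(2) zero_comp[OF i] HomD(5)[OF h(1)] by simp
    then obtain u where u: "u \<in> Hom A M V" "u \<cdot> p' = h"
      using cokernel_factor[OF short_exactD(8)[OF se(2)] i' h(1)] s by auto
    have "u \<cdot> p = zero_mor A (src A p) V"
      using comp_assoc[OF x(2) p' u(1)] pb u(2) h(2) by simp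
    then have "u = zero_mor A M V" using epic_zeroD[OF short_exactD(5)[OF se(1)] p u(1)] by simp
    then show "h = zero_mor A (src A p') V" using u zero_comp[OF p'] HomD(5)[OF u(1)] by simp
  qed
  ultimately obtain c where c: "c \<in> Hom A (src A p') (src A p)" "c \<cdot> b = idt A (src A p)" "b \<cdot> c = idt A (src A p')"
    using monic_epic_iso[OF _ _ x(2)] by blast
  have "c \<cdot> i' = i" using comp_assoc[OF i x(2) c(1)] bi c idt_comp[OF i] by simp
  moreover have "p \<cdot> c = p'" using comp_assoc[OF c(1) x(2) p'] pb c comp_idt[OF p'] by simp
  ultimately have "ladder A (i', p') (i, p) (idt A N) c (idt A M)"
    by (intro ladderI[OF se(2,1)]) (use s c idt_Hom N M comp_idt[OF i] idt_comp[OF p'] in auto)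
  then show ?thesis using ext by (auto simp: extension_rel_def e)
qed

lemma ladder_idt:
  assumes "short_exact A i p"
  shows "ladder A (i, p) (i, p) (idt A (src A i)) (idt A (src A p)) (idt A (tgt A p))"
  by (intro ladderI[OF assms assms])
    (use idt_Hom HomD[OF short_exactD(1)[OF assms]] HomD[OF short_exactD(2)[OF assms]] in auto)

text \<open>This ladder shows that \<open>Lambda\<close> preserves the zero class.\<close>

lemma ladder_zero:
  assumes se: "short_exact A j p" "short_exact A i q"
  shows "ladder A (j, p) (i, q) (zero_mor A (src A j) (src A i)) (zero_mor A (src A p) (src A q))
    (zero_mor A (tgt A p) (tgt A q))"
proof -
  note j = short_exactD(1)[OF se(1)] and p = short_exactD(2)[OF se(1)]
    and i = short_exactD(1)[OF se(2)] and q = short_exactD(2)[OF se(2)]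
  show ?thesis
    by (intro ladderI[OF se]) (use HomD(4,5)[OF j] HomD(4,5)[OF i] HomD(5)[OF p] HomD(5)[OF q] zero_Hom
      comp_zero[OF i] comp_zero[OF q] zero_comp[OF j] zero_comp[OF p] in auto)
qed

lemma extension_rel_refl:
  assumes "\<xi> \<in> extensions A M N"
  shows "(\<xi>, \<xi>) \<in> extension_rel A M N"
proof -
  obtain i p where e: "\<xi> = (i, p)" by (cases \<xi>)
  have se: "short_exact A i p" and s: "src A i = N" "tgt A p = M" using assms by (auto simp: e extensions_def)
  have "ladder A (i, p) (i, p) (idt A N) (idt A (src A p)) (idt A M)" using ladder_idt[OF se] s by simp
  then show ?thesis using assms by (auto simp: extension_rel_def e)
qed

lemma extensions_se: "\<xi> \<in> extensions A M N \<Longrightarrow> short_exact A (fst \<xi>) (snd \<xi>)"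
  by (auto simp: extensions_def)

lemma extensions_obj:
  assumes "\<xi> \<in> extensions A M N"
  shows "M \<in> obj A" "N \<in> obj A"
proof -
  obtain i p where "short_exact A i p" "src A i = N" "tgt A p = M" using assms by (auto simp: extensions_def)
  then show "M \<in> obj A" "N \<in> obj A" using short_exactD(1,2) HomD(4,5) by metis+
qed

lemma equiv_extension_rel: "equiv (extensions A M N) (extension_rel A M N)"
proof (rule equivI)
  show "extension_rel A M N \<subseteq> extensions A M N \<times> extensions A M N" by (auto simp: extension_rel_def)
  show "refl_on (extensions A M N) (extension_rel A M N)"
    using extension_rel_refl by (auto simp: refl_on_def extension_rel_def)
  show "sym (extension_rel A M N)" using extension_rel_sym by (auto simp: sym_def)
  show "trans (extension_rel A M N)"
  proof (rule transI)
    fix \<xi> \<eta> \<zeta> assume h: "(\<xi>, \<eta>) \<in> extension_rel A M N" "(\<eta>, \<zeta>) \<in> extension_rel A M N"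
    then obtain b b' where "ladder A \<xi> \<eta> (idt A N) b (idt A M)" "ladder A \<eta> \<zeta> (idt A N) b' (idt A M)"
      and E: "\<xi> \<in> extensions A M N" "\<eta> \<in> extensions A M N" "\<zeta> \<in> extensions A M N"
      by (auto simp: extension_rel_def)
    then have "ladder A \<xi> \<zeta> (idt A N \<cdot> idt A N) (b' \<cdot> b) (idt A M \<cdot> idt A M)"
      using ladder_comp extensions_se by blast
    then show "(\<xi>, \<zeta>) \<in> extension_rel A M N"
      using E extensions_obj[OF E(1)] by (auto simp: extension_rel_def)
  qed
qed

text \<open>By its universal property the constructed pushout maps, with identity ends, to every
  other extension in the set; conversely, composing with an equivalence stays in the set.\<close>

lemma ext_pushout_class:
  assumes se: "short_exact A j p" and g: "g \<in> Hom A (src A j) N"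
    and \<zeta>: "\<zeta> \<in> ext_pushout A (j, p) g"
  shows "ext_pushout A (j, p) g = extension_rel A (tgt A p) N `` {\<zeta>}"
proof -
  let ?M = "tgt A p"
  obtain i' p' b where E: "(i', p') \<in> extensions A ?M N" and l: "ladder A (j, p) (i', p') g b (idt A ?M)"
    and u: "\<forall>i q c b. short_exact A i q \<longrightarrow> src A i = N \<longrightarrow> ladder A (j, p) (i, q) g b c \<longrightarrow>
      (\<exists>u. ladder A (i', p') (i, q) (idt A N) u c)"
    using ex_pushout[OF se g] by blast
  have tg: "tgt A g = N" using g by (simp add: Hom_def)
  note o = extensions_obj[OF E]
  have "ext_pushout A (j, p) g = extension_rel A ?M N `` {(i', p')}"
  proof (intro equalityI subsetI)
    fix \<zeta> assume "\<zeta> \<in> ext_pushout A (j, p) g"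
    then show "\<zeta> \<in> extension_rel A ?M N `` {(i', p')}"
      using u E tg by (cases \<zeta>) (auto simp: ext_pushout_def extension_rel_def extensions_def)
  next
    fix \<zeta> assume "\<zeta> \<in> extension_rel A ?M N `` {(i', p')}"
    then obtain c where c: "ladder A (i', p') \<zeta> (idt A N) c (idt A ?M)" "\<zeta> \<in> extensions A ?M N"
      by (auto simp: extension_rel_def)
    have "ladder A (j, p) \<zeta> (idt A N \<cdot> g) (c \<cdot> b) (idt A ?M \<cdot> idt A ?M)"
      by (rule ladder_comp[OF l c(1)]) (use se extensions_se[OF E] extensions_se[OF c(2)] in auto)
    then show "\<zeta> \<in> ext_pushout A (j, p) g"
      using c(2) tg o idt_comp[OF g] by (auto simp: ext_pushout_def)
  qed
  then show ?thesis using \<zeta> equiv_class_eq[OF equiv_extension_rel] by blast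
qed

lemma ext_pushout_nonempty:
  assumes se: "short_exact A j p" and g: "g \<in> Hom A (src A j) N"
  shows "ext_pushout A (j, p) g \<noteq> {}"
proof -
  obtain i' p' b where "(i', p') \<in> extensions A (tgt A p) N" "ladder A (j, p) (i', p') g b (idt A (tgt A p))"
    using ex_pushout[OF assms] by blast
  then have "(i', p') \<in> ext_pushout A (j, p) g" using HomD(3)[OF g] by (auto simp: ext_pushout_def)
  then show ?thesis by blast
qed

lemma ext_pushout_Ext1:
  assumes se: "short_exact A j p" and g: "g \<in> Hom A (src A j) N"
  shows "ext_pushout A (j, p) g \<in> Ext1 A (tgt A p) N"
proof -
  obtain \<zeta> where z: "\<zeta> \<in> ext_pushout A (j, p) g" using ext_pushout_nonempty[OF assms] by blast
  then have "\<zeta> \<in> extensions A (tgt A p) N" using HomD(3)[OF g] by (simp add: ext_pushout_def)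
  then show ?thesis
    unfolding Ext1_def using ext_pushout_class[OF assms z] by (auto intro: quotientI)
qed

text \<open>The ladder factors through a pullback of \<open>(i, q)\<close> along \<open>f\<close>.
  The factor shows that this pullback is also a pushout of \<open>(j, p)\<close> along
  \<open>g\<close>, so both sets are its equivalence class.\<close>

lemma ext_pullback_eq_pushout:
  assumes l: "ladder A (j, p) (i, q) g b f" and sej: "short_exact A j p" and sei: "short_exact A i q"
  shows "ext_pullback A (i, q) f = ext_pushout A (j, p) g"
proof -
  note x = ladderD[OF l sej sei]
  obtain i' p' b' where E: "(i', p') \<in> extensions A (tgt A p) (src A i)"
    and l': "ladder A (i', p') (i, q) (idt A (src A i)) b' f"
    and u: "\<forall>k r a b. short_exact A k r \<longrightarrow> tgt A r = tgt A p \<longrightarrow> ladder A (k, r) (i, q) a b f \<longrightarrow>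
      (\<exists>u. ladder A (k, r) (i', p') a u (idt A (tgt A p)))"
    using ex_pullback[OF sei x(3)] by blast
  have sf: "src A f = tgt A p" and tg: "tgt A g = src A i" using x by (auto simp: Hom_def)
  note o = extensions_obj[OF E]
  have "ext_pullback A (i, q) f = extension_rel A (tgt A p) (src A i) `` {(i', p')}"
  proof (intro equalityI subsetI)
    fix \<zeta> assume "\<zeta> \<in> ext_pullback A (i, q) f"
    then have "(\<zeta>, (i', p')) \<in> extension_rel A (tgt A p) (src A i)"
      using u E sf by (cases \<zeta>) (auto simp: ext_pullback_def extension_rel_def extensions_def)
    then show "\<zeta> \<in> extension_rel A (tgt A p) (src A i) `` {(i', p')}" using extension_rel_sym by blast
  next
    fix \<zeta> assume "\<zeta> \<in> extension_rel A (tgt A p) (src A i) `` {(i', p')}"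
    then have "(\<zeta>, (i', p')) \<in> extension_rel A (tgt A p) (src A i)" using extension_rel_sym by blast
    then obtain c where c: "ladder A \<zeta> (i', p') (idt A (src A i)) c (idt A (tgt A p))"
      "\<zeta> \<in> extensions A (tgt A p) (src A i)" by (auto simp: extension_rel_def)
    have "ladder A \<zeta> (i, q) (idt A (src A i) \<cdot> idt A (src A i)) (b' \<cdot> c) (f \<cdot> idt A (tgt A p))"
      by (rule ladder_comp[OF c(1) l']) (use sei extensions_se[OF E] extensions_se[OF c(2)] in auto)
    then show "\<zeta> \<in> ext_pullback A (i, q) f"
      using c(2) sf o comp_idt[OF x(3)] by (auto simp: ext_pullback_def)
  qed
  moreover have "(i', p') \<in> ext_pushout A (j, p) g"
    using u[rule_format, OF sej refl l] E tg by (simp add: ext_pushout_def)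
  ultimately show ?thesis using ext_pushout_class[OF sej x(1)] by simp
qed

text \<open>Two maps of short exact sequences over the same map are homotopic; more generally this holds
  over maps that differ by one that lifts to the middle term.\<close>

lemma ladder_homotopy:
  assumes l: "ladder A (j, p) (i, q) a b c" and l': "ladder A (j, p) (i, q) a' b' c'"
    and sej: "short_exact A j p" and sei: "short_exact A i q"
    and s: "s \<in> Hom A (tgt A p) (src A q)" and c: "c = (q \<cdot> s) \<boxplus> c'"
  shows "\<exists>u\<in>Hom A (src A p) (src A i). a = (u \<cdot> j) \<boxplus> a'"
proof -
  note x = ladderD[OF l sej sei] and y = ladderD[OF l' sej sei]
  note j = short_exactD(1)[OF sej] and p = short_exactD(2)[OF sej]
    and i = short_exactD(1)[OF sei] and q = short_exactD(2)[OF sei]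
  have sp: "s \<cdot> p \<in> Hom A (src A p) (src A q)" and qs: "q \<cdot> s \<in> Hom A (tgt A p) (tgt A q)"
    using comp_Hom s p q by blast+
  \<comment> \<open>Adding the lift of \<open>c - c'\<close> to \<open>b'\<close> gives
    \<open>q \<cdot> e = c \<cdot> p\<close>, so \<open>b - e\<close> lands in the kernel
    \<open>i\<close>. On \<open>j\<close> the lift disappears because
    \<open>p \<cdot> j = 0\<close>.\<close>
  define e where "e = (s \<cdot> p) \<boxplus> b'"
  have e: "e \<in> Hom A (src A p) (src A q)" unfolding e_def using plus_Hom sp y by blast
  obtain d where d: "d \<in> Hom A (src A p) (src A q)" "b = d \<boxplus> e" using ex_minus[OF x(2) e] by blast
  have "q \<cdot> e = c \<cdot> p"
    unfolding e_def c using comp_plus[OF sp y(2) q] plus_comp[OF p qs y(3)] y(5) comp_assoc[OF p s q] by simp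
  then have "(q \<cdot> d) \<boxplus> (q \<cdot> e) = zero_mor A (src A p) (tgt A q) \<boxplus> (q \<cdot> e)"
    using x(5) comp_plus[OF d(1) e q] d(2) zero_plus[OF comp_Hom[OF e q]] by simp
  then have "q \<cdot> d = zero_mor A (src A p) (tgt A q)"
    using plus_right_cancel[OF comp_Hom[OF d(1) q] zero_Hom comp_Hom[OF e q]] HomD(4)[OF p] HomD(5)[OF q] by simp
  then obtain u where u: "u \<in> Hom A (src A p) (src A i)" "i \<cdot> u = d"
    using kernel_factor[OF short_exactD(7)[OF sei] q d(1)] by blast
  have uj: "u \<cdot> j \<in> Hom A (src A j) (src A i)" using comp_Hom u j by blast
  have "(s \<cdot> p) \<cdot> j = zero_mor A (src A j) (src A q)"
    using comp_assoc[OF j p s] short_exactD(3)[OF sej] comp_zero[OF s] HomD(4)[OF j] by simp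
  then have ej: "e \<cdot> j = i \<cdot> a'"
    unfolding e_def using plus_comp[OF j sp y(2)] y(4) zero_plus[OF comp_Hom[OF y(1) i]] by simp
  have "i \<cdot> a = i \<cdot> ((u \<cdot> j) \<boxplus> a')"
    using x(4) d(2) plus_comp[OF j d(1) e] ej u(2) comp_assoc[OF j u(1) i] comp_plus[OF uj y(1) i] by simp
  then have "a = (u \<cdot> j) \<boxplus> a'"
    using monicD[OF short_exactD(4)[OF sei] i x(1) plus_Hom[OF uj y(1)]] by simp
  then show ?thesis using u by blast
qed

text \<open>The pullback of the sequence along \<open>f\<close> is an extension of \<open>V\<close>,
  hence splits; a section followed by the middle map of the ladder is the lift.\<close>

lemma right_perp_lift:
  assumes se: "short_exact A i q" and perp: "src A i \<in> right_perp A W" and V: "V \<in> W"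
    and f: "f \<in> Hom A V (tgt A q)"
  shows "\<exists>g\<in>Hom A V (src A q). q \<cdot> g = f"
proof -
  obtain i' p' b where E: "(i', p') \<in> extensions A V (src A i)"
    and l: "ladder A (i', p') (i, q) (idt A (src A i)) b f"
    using ex_pullback[OF se f] by blast
  have "extension_rel A V (src A i) `` {(i', p')} \<in> Ext1 A V (src A i)"
    unfolding Ext1_def using E by (rule quotientI)
  then have "extension_rel A V (src A i) `` {(i', p')} = Ext1_zero A V (src A i)"
    using perp V by (auto simp: right_perp_def)
  then have "(i', p') \<in> Ext1_zero A V (src A i)" using extension_rel_refl[OF E] by auto
  then obtain s where s: "s \<in> Hom A V (src A p')" "p' \<cdot> s = idt A V" by (auto simp: Ext1_zero_def)
  have se': "short_exact A i' p'" and t: "tgt A p' = V" using E by (auto simp: extensions_def)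
  note x = ladderD[OF l se' se] and p' = short_exactD(2)[OF se', unfolded t]
  have "q \<cdot> (b \<cdot> s) = f"
    using comp_assoc[OF s(1) x(2) short_exactD(2)[OF se]] comp_assoc[OF s(1) p' f] x(5) s(2) comp_idt[OF f] by simp
  then show ?thesis using comp_Hom[OF s(1) x(2)] by blast
qed

end

section \<open>Precovers and stable morphisms\<close>

locale abelian_subcategory = abelian_category A for A :: "('o, 'm) precat" (structure) +
  fixes W :: "'o set"
  assumes additive: "additive_subcategory A W"
begin

section \<open>Morphisms factoring through \<open>W\<close> and stable hom-groups\<close>

lemma W_obj: "V \<in> W \<Longrightarrow> V \<in> obj A"
  using additive unfolding additive_subcategory_def by blast

lemma factoringI:
  assumes "g \<in> Hom A M V" "h \<in> Hom A V N" "V \<in> W"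
  shows "h \<cdot> g \<in> factoring A W M N"
  using assms comp_Hom[OF assms(1,2)] by (auto simp: factoring_def)

lemma factoring_Hom: "f \<in> factoring A W M N \<Longrightarrow> f \<in> Hom A M N"
  by (simp add: factoring_def)

lemma zero_factoring:
  assumes "M \<in> obj A" "N \<in> obj A"
  shows "zero_mor A M N \<in> factoring A W M N"
proof -
  obtain Z where Z: "Z \<in> W" using additive unfolding additive_subcategory_def by blast
  have "zero_mor A Z N \<cdot> zero_mor A M Z = zero_mor A M N"
    using comp_zero[OF zero_Hom] assms W_obj[OF Z] by simp
  then show ?thesis using factoringI[OF zero_Hom zero_Hom Z, of M N] assms W_obj[OF Z] by simp
qed

text \<open>The sum factors through the direct sum of the two intermediate objects.\<close>

lemma plus_factoring:
  assumes "f \<in> factoring A W M N" "f' \<in> factoring A W M N"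
  shows "f \<boxplus> f' \<in> factoring A W M N"
proof -
  obtain V g h V' g' h' where V: "V \<in> W" and g: "g \<in> Hom A M V" and h: "h \<in> Hom A V N" and f: "f = h \<cdot> g"
    and V': "V' \<in> W" and g': "g' \<in> Hom A M V'" and h': "h' \<in> Hom A V' N" and f': "f' = h' \<cdot> g'"
    using assms by (auto simp: factoring_def)
  obtain B i1 i2 p1 p2 where B: "biproduct A V V' B i1 i2 p1 p2"
    using ex_direct_sum W_obj V V' by (meson is_direct_sum_def)
  then have BW: "B \<in> W" using additive V V' unfolding additive_subcategory_def is_direct_sum_def by blast
  have i1: "i1 \<in> Hom A V B" and i2: "i2 \<in> Hom A V' B" and p1: "p1 \<in> Hom A B V" and p2: "p2 \<in> Hom A B V'"
    and pi: "p1 \<cdot> i1 = idt A V" "p2 \<cdot> i2 = idt A V'" "p1 \<cdot> i2 = zero_mor A V' V" "p2 \<cdot> i1 = zero_mor A V V'"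
    using B by (auto simp: biproduct_def)
  let ?s = "(i1 \<cdot> g) \<boxplus> (i2 \<cdot> g')" and ?t = "(h \<cdot> p1) \<boxplus> (h' \<cdot> p2)"
  have y: "i1 \<cdot> g \<in> Hom A M B" "i2 \<cdot> g' \<in> Hom A M B" "h \<cdot> p1 \<in> Hom A B N" "h' \<cdot> p2 \<in> Hom A B N"
    using comp_Hom g g' h h' i1 i2 p1 p2 by blast+
  have s: "?s \<in> Hom A M B" and t: "?t \<in> Hom A B N" using plus_Hom y by blast+
  have "p1 \<cdot> ?s = g"
    using comp_plus[OF y(1,2) p1] comp_assoc[OF g i1 p1] comp_assoc[OF g' i2 p1] pi idt_comp[OF g]
      zero_comp[OF g'] W_obj[OF V] zero_plus[OF g] by simp
  moreover have "p2 \<cdot> ?s = g'"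
    using comp_plus[OF y(1,2) p2] comp_assoc[OF g i1 p2] comp_assoc[OF g' i2 p2] pi idt_comp[OF g']
      zero_comp[OF g] W_obj[OF V'] zero_plus[OF g'] by simp
  ultimately have "?t \<cdot> ?s = f \<boxplus> f'"
    using plus_comp[OF s y(3,4)] comp_assoc[OF s p1 h] comp_assoc[OF s p2 h'] f f' by simp
  then show ?thesis using factoringI[OF s t BW] by simp
qed

lemma comp_factoring:
  assumes "f \<in> factoring A W M N" "g \<in> Hom A N L"
  shows "g \<cdot> f \<in> factoring A W M L"
proof -
  obtain V u v where "V \<in> W" and u: "u \<in> Hom A M V" and v: "v \<in> Hom A V N" and f: "f = v \<cdot> u"
    using assms by (auto simp: factoring_def)
  then show ?thesis using factoringI[OF u comp_Hom[OF v assms(2)]] comp_assoc[OF u v assms(2)] by simp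
qed

lemma factoring_comp:
  assumes "f \<in> factoring A W M N" "g \<in> Hom A L M"
  shows "f \<cdot> g \<in> factoring A W L N"
proof -
  obtain V u v where "V \<in> W" and u: "u \<in> Hom A M V" and v: "v \<in> Hom A V N" and f: "f = v \<cdot> u"
    using assms by (auto simp: factoring_def)
  then show ?thesis using factoringI[OF comp_Hom[OF assms(2) u] v] comp_assoc[OF assms(2) u v] by simp
qed

lemma subgroup_factoring:
  assumes M: "M \<in> obj A" and N: "N \<in> obj A"
  shows "subgroup (factoring A W M N) (hom_group A M N)"
proof -
  interpret G: comm_group "hom_group A M N" using hom_group M N .
  show ?thesis
  proof (rule G.subgroupI)
    show "factoring A W M N \<subseteq> carrier (hom_group A M N)" by (auto simp: hom_group_def factoring_def)
    show "factoring A W M N \<noteq> {}" using zero_factoring[OF M N] by blast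
    show "f \<otimes>\<^bsub>hom_group A M N\<^esub> f' \<in> factoring A W M N"
      if "f \<in> factoring A W M N" "f' \<in> factoring A W M N" for f f'
      using plus_factoring that by (simp add: hom_group_def)
    fix f assume f: "f \<in> factoring A W M N"
    then obtain V g h where V: "V \<in> W" and g: "g \<in> Hom A M V" and h: "h \<in> Hom A V N" and e: "f = h \<cdot> g"
      by (auto simp: factoring_def)
    \<comment> \<open>Here \<open>d\<close> is the negative of \<open>h\<close>, so the negative of
      \<open>h \<cdot> g\<close> factors through the same object \<open>V\<close>.\<close>
    obtain d where d: "d \<in> Hom A V N" "zero_mor A V N = d \<boxplus> h"
      using ex_minus[OF zero_Hom h] W_obj[OF V] N by blast
    have "(d \<cdot> g) \<boxplus> f = zero_mor A M N"
      using plus_comp[OF g d(1) h] d(2) zero_comp[OF g N] e by simp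
    then have "inv\<^bsub>hom_group A M N\<^esub> f = d \<cdot> g"
      using G.inv_equality[of "d \<cdot> g" f] factoring_Hom[OF f] comp_Hom[OF g d(1)] by (simp add: hom_group_def)
    then show "inv\<^bsub>hom_group A M N\<^esub> f \<in> factoring A W M N" using factoringI[OF g d(1) V] by simp
  qed
qed

lemma group_stable_hom:
  assumes "M \<in> obj A" "N \<in> obj A"
  shows "group (stable_hom A W M N)"
  unfolding stable_hom_def
  by (intro normal.factorgroup_is_group comm_group.subgroup_imp_normal hom_group subgroup_factoring assms)

lemma carrier_stable_hom: "carrier (stable_hom A W M N) = stable_class A W M N ` Hom A M N"
  by (auto simp: stable_hom_def FactGroup_def RCOSETS_def stable_class_def hom_group_def)

lemma stable_class_eq: "stable_class A W M N f = {d \<boxplus> f | d. d \<in> factoring A W M N}"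
  by (auto simp: stable_class_def r_coset_def hom_group_def)

lemma stable_class_cong:
  assumes "f \<in> Hom A M N" "f = d \<boxplus> f'" "d \<in> factoring A W M N" "f' \<in> Hom A M N"
  shows "stable_class A W M N f = stable_class A W M N f'"
proof -
  interpret G: comm_group "hom_group A M N" by (rule hom_group[OF HomD(4,5)[OF assms(1)]])
  have "f \<in> stable_class A W M N f'" using assms by (auto simp: stable_class_eq)
  then show ?thesis
    using G.repr_independence[of f "factoring A W M N" f'] subgroup_factoring HomD[OF assms(1)] assms(4)
    by (simp add: stable_class_def hom_group_def)
qed

lemma stable_class_self:
  assumes "f \<in> Hom A M N"
  shows "f \<in> stable_class A W M N f"
proof -
  have "zero_mor A M N \<in> factoring A W M N" using zero_factoring HomD(4,5)[OF assms] by blast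
  then show ?thesis using zero_plus(1)[OF assms, symmetric] unfolding stable_class_eq by blast
qed

lemma one_stable_hom:
  assumes "M \<in> obj A" "N \<in> obj A"
  shows "\<one>\<^bsub>stable_hom A W M N\<^esub> = stable_class A W M N (zero_mor A M N)"
proof -
  have "d \<boxplus> zero_mor A M N = d" if "d \<in> factoring A W M N" for d
    using zero_plus(2)[OF factoring_Hom[OF that]] .
  then have "stable_class A W M N (zero_mor A M N) = factoring A W M N"
    unfolding stable_class_eq Setcompr_eq_image by simp
  then show ?thesis by (simp add: stable_hom_def FactGroup_def)
qed

lemma stable_class_eq_zero:
  assumes f: "f \<in> Hom A M N"
  shows "stable_class A W M N f = stable_class A W M N (zero_mor A M N) \<longleftrightarrow> f \<in> factoring A W M N"
proof
  assume "stable_class A W M N f = stable_class A W M N (zero_mor A M N)"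
  then obtain d where "d \<in> factoring A W M N" "f = d \<boxplus> zero_mor A M N"
    using stable_class_self[OF f] by (auto simp: stable_class_eq)
  then show "f \<in> factoring A W M N" using zero_plus factoring_Hom by metis
next
  assume "f \<in> factoring A W M N"
  then show "stable_class A W M N f = stable_class A W M N (zero_mor A M N)"
    using stable_class_cong[OF f, of f "zero_mor A M N"] zero_plus[OF f] zero_Hom HomD[OF f] by simp
qed

text \<open>The lifting property of a special precover without orthogonality of the kernel; the
  syzygy sequences of an arbitrary proper resolution satisfy it.\<close>

definition precover :: "'m \<Rightarrow> 'm \<Rightarrow> bool" where
  "precover i p \<longleftrightarrow> short_exact A i p \<and> src A p \<in> W \<and>
     (\<forall>V\<in>W. \<forall>f\<in>Hom A V (tgt A p). \<exists>g\<in>Hom A V (src A p). p \<cdot> g = f)"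

lemma special_precover_precover:
  assumes "special_precover A W M (i, p)"
  shows "precover i p" "tgt A p = M" "src A i \<in> right_perp A W"
proof -
  have h: "short_exact A i p" "src A p \<in> W" "src A i \<in> right_perp A W" "tgt A p = M"
    using assms by (auto simp: special_precover_def extensions_def)
  then show "precover i p" "tgt A p = M" "src A i \<in> right_perp A W"
    using right_perp_lift[OF h(1,3)] by (auto simp: precover_def)
qed

text \<open>The middle term \<open>src A p\<close> lies in \<open>W\<close>, so
  \<open>f \<cdot> p\<close> lifts along \<open>q\<close>; the lift restricts to the
  kernels.\<close>

lemma ex_ladder:
  assumes pc: "precover j p" "precover i q" and f: "f \<in> Hom A (tgt A p) (tgt A q)"
  shows "\<exists>a b. ladder A (j, p) (i, q) a b f"
proof -
  have se: "short_exact A j p" "short_exact A i q" using pc by (auto simp: precover_def)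
  note j = short_exactD(1)[OF se(1)] and p = short_exactD(2)[OF se(1)]
    and i = short_exactD(1)[OF se(2)] and q = short_exactD(2)[OF se(2)]
  obtain b where b: "b \<in> Hom A (src A p) (src A q)" "q \<cdot> b = f \<cdot> p"
    using pc comp_Hom[OF p f] by (meson precover_def)
  have bj: "b \<cdot> j \<in> Hom A (src A j) (src A q)" using comp_Hom j b by blast
  have "q \<cdot> (b \<cdot> j) = zero_mor A (src A j) (tgt A q)"
    using comp_assoc[OF j b(1) q] b(2) comp_assoc[OF j p f] short_exactD(3)[OF se(1)]
      comp_zero[OF f] HomD(4)[OF j] by simp
  then obtain a where "a \<in> Hom A (src A j) (src A i)" "i \<cdot> a = b \<cdot> j"
    using kernel_factor[OF short_exactD(7)[OF se(2)] q bj] by blast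
  then have "ladder A (j, p) (i, q) a b f" using b f by (intro ladderI[OF se]) auto
  then show ?thesis by blast
qed

text \<open>The difference \<open>d\<close> of the right ends passes through an object of
  \<open>W\<close>, so it lifts along \<open>q\<close> and the homotopy lemma applies. The left ends
  then differ by a morphism through \<open>src A p\<close>, again in \<open>W\<close>.\<close>

lemma ladder_stable:
  assumes pc: "precover j p" "precover i q"
    and l: "ladder A (j, p) (i, q) a b c" and l': "ladder A (j, p) (i, q) a' b' c'"
    and c: "c = d \<boxplus> c'" and d: "d \<in> factoring A W (tgt A p) (tgt A q)"
  shows "\<exists>e\<in>factoring A W (src A j) (src A i). a = e \<boxplus> a'"
proof -
  have se: "short_exact A j p" "short_exact A i q" using pc by (auto simp: precover_def)
  obtain V t h where V: "V \<in> W" and t: "t \<in> Hom A (tgt A p) V" and h: "h \<in> Hom A V (tgt A q)" and e: "d = h \<cdot> t"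
    using d by (auto simp: factoring_def)
  obtain h' where h': "h' \<in> Hom A V (src A q)" "q \<cdot> h' = h" using pc V h by (meson precover_def)
  have "h' \<cdot> t \<in> Hom A (tgt A p) (src A q)" and "c = (q \<cdot> (h' \<cdot> t)) \<boxplus> c'"
    using comp_Hom[OF t h'(1)] comp_assoc[OF t h'(1) short_exactD(2)[OF se(2)]] h' e c by simp_all
  then obtain u where "u \<in> Hom A (src A p) (src A i)" "a = (u \<cdot> j) \<boxplus> a'"
    using ladder_homotopy[OF l l' se] by blast
  then show ?thesis using factoringI[OF short_exactD(1)[OF se(1)]] pc by (auto simp: precover_def)
qed

text \<open>\<open>beta\<close> is well defined because the sequence \<open>(j, p)\<close> has its middle term in \<open>W\<close>:
  two morphisms with the same pushout differ by one that factors through \<open>j\<close>.\<close>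

lemma beta_pushout:
  assumes se: "short_exact A j p" and P: "src A p \<in> W" and perp: "src A k \<in> right_perp A W"
    and g: "g \<in> Hom A (src A j) (src A k)"
  shows "beta A W (j, p) (k, q) (ext_pushout A (j, p) g) = stable_class A W (src A j) (src A k) g"
proof -
  let ?J = "src A j" and ?K = "src A k" and ?M = "tgt A p"
  note j = short_exactD(1)[OF se] and p = short_exactD(2)[OF se]
  let ?\<Phi> = "\<lambda>\<beta>. \<beta> \<in> Ext1 A ?M ?K \<rightarrow>\<^sub>E carrier (stable_hom A W ?J ?K) \<and>
        (\<forall>g\<in>Hom A ?J ?K. \<beta> (ext_pushout A (j, p) g) = stable_class A W ?J ?K g)"
  have wd: "stable_class A W ?J ?K g = stable_class A W ?J ?K g'"
    if g: "g \<in> Hom A ?J ?K" "g' \<in> Hom A ?J ?K" and eq: "ext_pushout A (j, p) g = ext_pushout A (j, p) g'" for g g'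
  proof -
    obtain \<zeta> where \<zeta>: "\<zeta> \<in> ext_pushout A (j, p) g" "\<zeta> \<in> ext_pushout A (j, p) g'"
      using ext_pushout_nonempty[OF se g(1)] eq by blast
    obtain b b' where E: "\<zeta> \<in> extensions A ?M ?K" and l: "ladder A (j, p) \<zeta> g b (idt A ?M)" "ladder A (j, p) \<zeta> g' b' (idt A ?M)"
      using \<zeta> HomD(3)[OF g(1)] HomD(3)[OF g(2)] by (auto simp: ext_pushout_def)
    obtain i r where \<zeta>: "\<zeta> = (i, r)" by (cases \<zeta>)
    then have sei: "short_exact A i r" and s: "src A i = ?K" "tgt A r = ?M" using E by (auto simp: extensions_def)
    note r = short_exactD(2)[OF sei, unfolded s] and M = HomD(5)[OF p]
    \<comment> \<open>Both ladders end in the same extension with the same right end, so the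
      homotopy lemma is used with the zero lift.\<close>
    have "\<exists>u\<in>Hom A (src A p) (src A i). g = (u \<cdot> j) \<boxplus> g'"
      by (rule ladder_homotopy[OF l[unfolded \<zeta>] se sei, of "zero_mor A ?M (src A r)"])
        (use M HomD(4)[OF r] zero_Hom comp_zero[OF r M] zero_plus[OF idt_Hom[OF M]] in auto)
    then obtain u where u: "u \<in> Hom A (src A p) ?K" "g = (u \<cdot> j) \<boxplus> g'" using s by auto
    then show ?thesis using stable_class_cong[OF g(1) u(2) factoringI[OF j u(1) P] g(2)] by blast
  qed
  \<comment> \<open>Surjectivity of the connecting map. As \<open>src A p\<close> is in
    \<open>W\<close> and the kernel of \<open>r\<close> is orthogonal to \<open>W\<close>, the map
    \<open>p\<close> lifts along \<open>r\<close>; restricting the lift to the kernels gives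
    \<open>g\<close>.\<close>
  have surj: "\<exists>g\<in>Hom A ?J ?K. x = ext_pushout A (j, p) g" if x: "x \<in> Ext1 A ?M ?K" for x
  proof -
    obtain i r where E: "(i, r) \<in> extensions A ?M ?K" and x: "x = extension_rel A ?M ?K `` {(i, r)}"
      using x by (force simp: Ext1_def quotient_def)
    have sei: "short_exact A i r" and s: "src A i = ?K" "tgt A r = ?M" using E by (auto simp: extensions_def)
    note i = short_exactD(1)[OF sei, unfolded s] and r = short_exactD(2)[OF sei, unfolded s]
    obtain b where b: "b \<in> Hom A (src A p) (src A r)" "r \<cdot> b = p"
      using right_perp_lift[OF sei _ P, of p] perp s p by auto
    have bj: "b \<cdot> j \<in> Hom A ?J (src A r)" using comp_Hom j b by blast
    have "r \<cdot> (b \<cdot> j) = zero_mor A ?J ?M"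
      using comp_assoc[OF j b(1) r] b(2) short_exactD(3)[OF se] by simp
    then obtain g where g: "g \<in> Hom A ?J ?K" "i \<cdot> g = b \<cdot> j"
      using kernel_factor[OF short_exactD(7)[OF sei] r bj] s by auto
    have "ladder A (j, p) (i, r) g b (idt A ?M)"
      by (intro ladderI[OF se sei]) (use s g b HomD(5)[OF p] idt_Hom idt_comp[OF p] in auto)
    then have "(i, r) \<in> ext_pushout A (j, p) g" using E HomD(3)[OF g(1)] by (auto simp: ext_pushout_def)
    then show ?thesis using ext_pushout_class[OF se g(1)] x g(1) by blast
  qed
  \<comment> \<open>\<open>G\<close> picks a representative of each class; by \<open>wd\<close> the
    resulting map does not depend on the choice.\<close>
  obtain G where G: "G x \<in> Hom A ?J ?K" "x = ext_pushout A (j, p) (G x)" if "x \<in> Ext1 A ?M ?K" for x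
    using surj by metis
  define \<beta>0 where "\<beta>0 = (\<lambda>x\<in>Ext1 A ?M ?K. stable_class A W ?J ?K (G x))"
  have \<beta>0: "?\<Phi> \<beta>0"
  proof (intro conjI ballI)
    show "\<beta>0 \<in> Ext1 A ?M ?K \<rightarrow>\<^sub>E carrier (stable_hom A W ?J ?K)"
      using G by (auto simp: \<beta>0_def carrier_stable_hom)
    fix g assume g: "g \<in> Hom A ?J ?K"
    have x: "ext_pushout A (j, p) g \<in> Ext1 A ?M ?K" using ext_pushout_Ext1[OF se g] .
    show "\<beta>0 (ext_pushout A (j, p) g) = stable_class A W ?J ?K g"
      using wd[OF g G[OF x]] x by (simp add: \<beta>0_def)
  qed
  have uniq: "\<beta> = \<beta>0" if "?\<Phi> \<beta>" for \<beta>
  proof (rule extensionalityI[of _ "Ext1 A ?M ?K"])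
    show "\<beta> \<in> extensional (Ext1 A ?M ?K)" "\<beta>0 \<in> extensional (Ext1 A ?M ?K)"
      using that \<beta>0 by (auto simp: PiE_def)
    show "\<beta> x = \<beta>0 x" if "x \<in> Ext1 A ?M ?K" for x
      using surj[OF that] \<open>?\<Phi> \<beta>\<close> \<beta>0 by auto
  qed
  have "beta A W (j, p) (k, q) = \<beta>0"
    unfolding beta_def Let_def fst_conv snd_conv by (rule the_equality[of ?\<Phi>, OF \<beta>0 uniq])
  then show ?thesis using \<beta>0 g by simp
qed

text \<open>Every \<open>f'\<close> in the class of \<open>f\<close> is the right end of a ladder
  with the same left end \<open>g\<close>: the correction through \<open>W\<close> lifts to the
  middle term and dies on \<open>j\<close>. Hence the image taken in \<open>delta_bar\<close> is a
  singleton, the pushout along \<open>g\<close>, on which \<open>beta\<close> is known.\<close>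

lemma Lambda_stable_class:
  assumes \<xi>: "special_precover A W M (j, p)" and \<eta>: "special_precover A W N (i, q)"
    and l: "ladder A (j, p) (i, q) g b f"
  shows "Lambda A W (j, p) (i, q) (stable_class A W M N f) = stable_class A W (src A j) (src A i) g"
proof -
  note pc = special_precover_precover[OF \<xi>] special_precover_precover[OF \<eta>]
  have se: "short_exact A j p" "short_exact A i q" "src A p \<in> W" using pc by (auto simp: precover_def)
  note x = ladderD[OF l se(1,2)]
  note j = short_exactD(1)[OF se(1)] and p = short_exactD(2)[OF se(1), unfolded pc]
    and q = short_exactD(2)[OF se(2), unfolded pc]
  have f: "f \<in> Hom A M N" using x pc by simp
  have same: "ext_pullback A (i, q) f' = ext_pushout A (j, p) g" if f': "f' \<in> stable_class A W M N f" for f'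
  proof -
    obtain V t h where V: "V \<in> W" and t: "t \<in> Hom A M V" and h: "h \<in> Hom A V N" and f': "f' = (h \<cdot> t) \<boxplus> f"
      using f' by (auto simp: stable_class_eq factoring_def)
    obtain h' where h': "h' \<in> Hom A V (src A q)" "q \<cdot> h' = h" using pc V h by (metis precover_def)
    have s: "h' \<cdot> t \<in> Hom A M (src A q)" and ht: "h \<cdot> t \<in> Hom A M N" using t h h' comp_Hom by blast+
    have sp: "(h' \<cdot> t) \<cdot> p \<in> Hom A (src A p) (src A q)" using comp_Hom p s by blast
    have "((h' \<cdot> t) \<cdot> p) \<cdot> j = zero_mor A (src A j) (src A q)"
      using comp_assoc[OF j p s] short_exactD(3)[OF se(1)] comp_zero[OF s] HomD(4)[OF j] pc by simp
    then have 1: "(((h' \<cdot> t) \<cdot> p) \<boxplus> b) \<cdot> j = i \<cdot> g"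
      using plus_comp[OF j sp x(2)] x(4) zero_plus[OF comp_Hom[OF x(1) short_exactD(1)[OF se(2)]]] by simp
    have "q \<cdot> ((h' \<cdot> t) \<cdot> p) = (h \<cdot> t) \<cdot> p"
      using comp_assoc[OF p s q] comp_assoc[OF t h'(1) q] h'(2) by simp
    then have 2: "f' \<cdot> p = q \<cdot> (((h' \<cdot> t) \<cdot> p) \<boxplus> b)"
      using comp_plus[OF sp x(2) q] plus_comp[OF p ht f] x(5) f' by simp
    have "ladder A (j, p) (i, q) g (((h' \<cdot> t) \<cdot> p) \<boxplus> b) f'"
      by (intro ladderI[OF se(1,2)]) (use x 1 2 pc plus_Hom[OF sp x(2)] plus_Hom[OF ht f] f' in auto)
    then show ?thesis using ext_pullback_eq_pushout se by blast
  qed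
  have "ext_pullback A (i, q) ` stable_class A W M N f = {ext_pushout A (j, p) g}"
    using same stable_class_self[OF f] by blast
  then show ?thesis
    using beta_pushout[OF se(1,3) _ x(1)] pc by (simp add: Lambda_def delta_bar_def)
qed

end

section \<open>Syzygies\<close>

context abelian_category
begin

section \<open>Exactness lemmas for resolutions\<close>

lemma cokernel_unique:
  "is_cokernel A f k \<Longrightarrow> is_cokernel A f m \<Longrightarrow> is_cokernel A g m \<Longrightarrow> is_cokernel A g k"
  using abelian_category.kernel_unique[OF abelian_dual, of f k m g] by simp

lemma zero_object_Hom:
  assumes "zero_object A Z"
  shows "f \<in> Hom A X Z \<Longrightarrow> f = zero_mor A X Z" "f \<in> Hom A Z X \<Longrightarrow> f = zero_mor A Z X"
proof -
  have Z: "Z \<in> obj A" using assms by (simp add: zero_object_def)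
  show "f = zero_mor A X Z" if f: "f \<in> Hom A X Z"
    using assms f zero_Hom[OF HomD(4)[OF f] Z] HomD(4)[OF f] unfolding zero_object_def by blast
  show "f = zero_mor A Z X" if f: "f \<in> Hom A Z X"
    using assms f zero_Hom[OF Z HomD(5)[OF f]] HomD(5)[OF f] unfolding zero_object_def by blast
qed

text \<open>Pull the epic \<open>q\<close> back along a test morphism \<open>x\<close> with
  \<open>j \<cdot> x = 0\<close>. The lift of \<open>x\<close> then lies in the kernel
  \<open>m\<close>, so \<open>x\<close> vanishes after composition with the pulled-back epic, which
  cancels.\<close>

lemma monic_from_coimage:
  assumes se: "short_exact A m q" and ker: "is_kernel A (j \<cdot> q) m" and j: "j \<in> Hom A (tgt A q) Y"
  shows "monic A j"
proof (rule monicI[OF j])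
  note q = short_exactD(2)[OF se]
  have jq: "j \<cdot> q \<in> Hom A (src A q) Y" using comp_Hom q j by blast
  fix V x assume x: "x \<in> Hom A V (tgt A q)" "j \<cdot> x = zero_mor A V Y"
  obtain i' p' b where E: "(i', p') \<in> extensions A V (src A m)"
    and l: "ladder A (i', p') (m, q) (idt A (src A m)) b x"
    using ex_pullback[OF se x(1)] by blast
  have se': "short_exact A i' p'" and t: "tgt A p' = V" using E by (auto simp: extensions_def)
  note y = ladderD[OF l se' se] and p' = short_exactD(2)[OF se', unfolded t]
  have "(j \<cdot> q) \<cdot> b = zero_mor A (src A p') Y"
    using comp_assoc[OF y(2) q j] y(5) comp_assoc[OF p' x(1) j] x(2) zero_comp[OF p'] HomD(5)[OF j] by simp
  then obtain u where u: "u \<in> Hom A (src A p') (src A m)" "m \<cdot> u = b"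
    using kernel_factor[OF ker jq y(2)] by blast
  have "x \<cdot> p' = zero_mor A (src A p') (tgt A q)"
    using y(5) comp_assoc[OF u(1) short_exactD(1)[OF se] q] u(2) short_exactD(3)[OF se]
      zero_comp[OF u(1)] HomD(5)[OF q] by simp
  then show "x = zero_mor A V (tgt A q)" using epic_zeroD[OF short_exactD(5)[OF se'] p' x(1)] by simp
qed

lemma exact_at_kernel:
  assumes "short_exact A i q" "is_kernel A g i"
  shows "exact_at A i g"
  unfolding exact_at_def is_image_def using assms short_exactD(7,8) by blast

text \<open>The zero morphism out of \<open>Z\<close> is its own image, since its cokernel is the
  identity of \<open>X\<close>. This covers the zero tail of a truncated resolution.\<close>

lemma exact_at_zero_monic:
  assumes Z: "zero_object A Z" and f: "monic A f" "f \<in> Hom A X Y"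
  shows "exact_at A (zero_mor A Z X) f"
proof -
  note X = HomD(4)[OF f(2)]
  have Zo: "Z \<in> obj A" using Z by (simp add: zero_object_def)
  note z = zero_Hom[OF Zo X]
  have m: "monic A (zero_mor A Z X)"
    by (rule monicI[OF z]) (use zero_object_Hom(1)[OF Z] in blast)
  have ker: "is_kernel A g (zero_mor A Z X)" if g: "monic A g" "g \<in> Hom A X V" for g V
  proof (rule is_kernelI[OF g(2) z comp_zero[OF g(2) Zo] m])
    fix U h assume h: "h \<in> Hom A U X" "g \<cdot> h = zero_mor A U V"
    have "zero_mor A Z X \<cdot> zero_mor A U Z = h"
      using monic_zeroD[OF g h] comp_zero[OF z HomD(4)[OF h(1)]] by simp
    then show "\<exists>u\<in>Hom A U Z. zero_mor A Z X \<cdot> u = h" using zero_Hom[OF HomD(4)[OF h(1)] Zo] by blast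
  qed
  note id = idt_Hom[OF X]
  have "monic A (idt A X)" "epic A (idt A X)"
    using idt_comp comp_idt by (auto intro!: monicI[OF id] epicI[OF id])
  then have "is_kernel A (idt A X) (zero_mor A Z X)" "is_cokernel A (zero_mor A Z X) (idt A X)"
    using ker[OF _ id] epic_cokernel_of_kernel by blast+
  then show ?thesis unfolding exact_at_def is_image_def using ker[OF f] by blast
qed

end

context abelian_subcategory
begin

text \<open>A special proper resolution without the orthogonality condition: this much can be had
  from any resolution counted by \<open>W_pd\<close>.\<close>

definition syzygies :: "'o \<Rightarrow> ('o, 'm) syzygy_resolution \<Rightarrow> bool" where
  "syzygies M R \<longleftrightarrow> proper_resolution A W M R \<and> cok R 0 = bd R 0 \<and>
     (\<forall>i\<ge>1. is_cokernel A (bd R (Suc i)) (cok R i))"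

lemma syzygies_special:
  "special_proper_resolution A W M R \<Longrightarrow> syzygies M R"
  by (simp add: special_proper_resolution_def syzygies_def)

section \<open>Short exact sequences of syzygies\<close>

lemma proper_resolution_bd:
  assumes "proper_resolution A W M R"
  shows "cx R n \<in> W" "bd R 0 \<in> Hom A (cx R 0) M" "bd R (Suc n) \<in> Hom A (cx R (Suc n)) (cx R n)"
  using assms unfolding proper_resolution_def by blast+

lemma proper_resolution_lift:
  assumes R: "proper_resolution A W M R" and V: "V \<in> W"
  shows "f \<in> Hom A V M \<Longrightarrow> \<exists>g\<in>Hom A V (cx R 0). bd R 0 \<cdot> g = f"
    and "f \<in> Hom A V (cx R n) \<Longrightarrow> bd R n \<cdot> f = zero_mor A V (tgt A (bd R n)) \<Longrightarrow>
      \<exists>g\<in>Hom A V (cx R (Suc n)). bd R (Suc n) \<cdot> g = f"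
proof -
  have 1: "(\<lambda>g. bd R 0 \<cdot> g) ` Hom A V (cx R 0) = Hom A V M"
    and 2: "{f \<in> Hom A V (cx R n). bd R n \<cdot> f = zero_mor A V (tgt A (bd R n))}
            = (\<lambda>g. bd R (Suc n) \<cdot> g) ` Hom A V (cx R (Suc n))"
    using R V unfolding proper_resolution_def by blast+
  show "\<exists>g\<in>Hom A V (cx R 0). bd R 0 \<cdot> g = f" if "f \<in> Hom A V M"
  proof -
    have "f \<in> (\<lambda>g. bd R 0 \<cdot> g) ` Hom A V (cx R 0)" using that 1 by simp
    then show ?thesis by auto
  qed
  show "\<exists>g\<in>Hom A V (cx R (Suc n)). bd R (Suc n) \<cdot> g = f"
    if "f \<in> Hom A V (cx R n)" "bd R n \<cdot> f = zero_mor A V (tgt A (bd R n))"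
  proof -
    have "f \<in> (\<lambda>g. bd R (Suc n) \<cdot> g) ` Hom A V (cx R (Suc n))" using that 2 by blast
    then show ?thesis by auto
  qed
qed

lemma cok_cokernel:
  assumes "syzygies M R"
  shows "is_cokernel A (bd R (Suc i)) (cok R i)"
proof (cases i)
  case 0
  have "is_cokernel A (bd R 1) (bd R 0)" "cok R 0 = bd R 0"
    using assms unfolding syzygies_def proper_resolution_def by blast+
  then show ?thesis using 0 by simp
next
  case (Suc k)
  then show ?thesis using assms by (simp add: syzygies_def)
qed

lemma cok_Hom:
  assumes "syzygies M R"
  shows "cok R i \<in> Hom A (cx R i) (Omega A R i)"
proof -
  have "proper_resolution A W M R" using assms by (simp add: syzygies_def)
  then show ?thesis
    using cokernelD(1)[OF cok_cokernel[OF assms] proper_resolution_bd(3)] by (simp add: Omega_def)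
qed

lemma Omega_obj: "syzygies M R \<Longrightarrow> Omega A R i \<in> obj A"
  using HomD(5)[OF cok_Hom] .

lemma Omega_0: "syzygies M R \<Longrightarrow> Omega A R 0 = M"
  using HomD(3)[OF proper_resolution_bd(2)] by (auto simp: Omega_def syzygies_def)

text \<open>By exactness, \<open>cok R (Suc i)\<close> is also the cokernel of the kernel of
  \<open>bd R (Suc i)\<close>, that is, the coimage of this differential. The induced map is
  therefore monic, and it is unique because \<open>cok R (Suc i)\<close> is epic.\<close>

lemma syzygy_incl:
  assumes R: "syzygies M R"
  shows "syzygy_incl A R i \<in> Hom A (Omega A R (Suc i)) (cx R i)"
    "syzygy_incl A R i \<cdot> cok R (Suc i) = bd R (Suc i)"
    "monic A (syzygy_incl A R i)"
proof -
  have pr: "proper_resolution A W M R" using R by (simp add: syzygies_def)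
  note d1 = proper_resolution_bd(3)[OF pr, of i] and d2 = proper_resolution_bd(3)[OF pr, of "Suc i"]
  note c = cok_cokernel[OF R, of "Suc i"] and cH = cok_Hom[OF R, of "Suc i"]
  obtain m q where q: "is_cokernel A (bd R (Suc (Suc i))) q" "is_kernel A q m" and m: "is_kernel A (bd R (Suc i)) m"
    using pr unfolding proper_resolution_def exact_at_def is_image_def by blast
  have "epic A q" using cokernel_epic[OF q(1)] .
  then have "is_cokernel A m (cok R (Suc i))"
    using cokernel_unique[OF c q(1)] epic_cokernel_of_kernel q(2) by blast
  then have se: "short_exact A m (cok R (Suc i))"
    using monic_kernel_of_cokernel[OF kernel_monic[OF m]] by (simp add: short_exact_iff)
  have "bd R (Suc i) \<cdot> bd R (Suc (Suc i)) = zero_mor A (cx R (Suc (Suc i))) (cx R i)"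
  proof -
    have qH: "q \<in> Hom A (cx R (Suc i)) (tgt A q)" using cokernelD[OF q(1) d2] by blast
    have "q \<cdot> bd R (Suc (Suc i)) = zero_mor A (cx R (Suc (Suc i))) (tgt A q)" using cokernelD[OF q(1) d2] by blast
    then obtain u where u: "u \<in> Hom A (cx R (Suc (Suc i))) (src A m)" "m \<cdot> u = bd R (Suc (Suc i))"
      using kernel_factor[OF q(2) qH d2] by blast
    show ?thesis
      using comp_assoc[OF u(1) kernelD(1)[OF m d1] d1] kernelD(2)[OF m d1] zero_comp[OF u(1) HomD(5)[OF d1]] u(2)
      by simp
  qed
  then obtain j where j: "j \<in> Hom A (Omega A R (Suc i)) (cx R i)" "j \<cdot> cok R (Suc i) = bd R (Suc i)"
    using cokernel_factor[OF c d2 d1] HomD(3)[OF cH] by auto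
  have "syzygy_incl A R i = j"
    unfolding syzygy_incl_def
    using j epicD[OF cokernel_epic[OF c] cH] by (intro the_equality) auto
  moreover have "monic A j"
    using monic_from_coimage[OF se, of j "cx R i"] j m HomD(3)[OF cH] by simp
  ultimately show "syzygy_incl A R i \<in> Hom A (Omega A R (Suc i)) (cx R i)"
    "syzygy_incl A R i \<cdot> cok R (Suc i) = bd R (Suc i)" "monic A (syzygy_incl A R i)"
    using j by simp_all
qed

text \<open>Since \<open>cok R (Suc i)\<close> is epic, a morphism kills the inclusion iff it kills
  the differential, so the two have the same cokernel.\<close>

lemma syzygy_short_exact:
  assumes R: "syzygies M R"
  shows "short_exact A (syzygy_incl A R i) (cok R i)"
proof -
  note j = syzygy_incl[OF R, of i] and c = cok_cokernel[OF R, of i] and cH = cok_Hom[OF R]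
  have pr: "proper_resolution A W M R" using R by (simp add: syzygies_def)
  note d = proper_resolution_bd(3)[OF pr, of i]
  note e = cokernel_epic[OF cok_cokernel[OF R, of "Suc i"]]
  have z: "f \<cdot> syzygy_incl A R i = zero_mor A (Omega A R (Suc i)) V \<longleftrightarrow> f \<cdot> bd R (Suc i) = zero_mor A (cx R (Suc i)) V"
    if f: "f \<in> Hom A (cx R i) V" for f V
  proof -
    have a: "f \<cdot> bd R (Suc i) = (f \<cdot> syzygy_incl A R i) \<cdot> cok R (Suc i)"
      using comp_assoc[OF cH j(1) f] j(2) by simp
    show ?thesis
      unfolding a using epic_zeroD[OF e cH comp_Hom[OF j(1) f]] zero_comp[OF cH HomD(5)[OF f], of "Suc i"] by metis
  qed
  have "is_cokernel A (syzygy_incl A R i) (cok R i)"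
  proof (rule is_cokernelI[OF j(1) cH])
    show "cok R i \<cdot> syzygy_incl A R i = zero_mor A (Omega A R (Suc i)) (Omega A R i)"
      using z[OF cH] cokernelD(2)[OF c d] HomD(3)[OF cH] by simp
    show "epic A (cok R i)" using cokernel_epic[OF c] .
    fix V h assume h: "h \<in> Hom A (cx R i) V" "h \<cdot> syzygy_incl A R i = zero_mor A (Omega A R (Suc i)) V"
    then show "\<exists>u\<in>Hom A (Omega A R i) V. u \<cdot> cok R i = h"
      using cokernel_factor[OF c d h(1)] z[OF h(1)] HomD(3)[OF cH] by simp
  qed
  then show ?thesis using monic_kernel_of_cokernel[OF j(3)] by (simp add: short_exact_iff)
qed

text \<open>For positive \<open>i\<close> the differential is \<open>cok R i\<close> followed by a
  monic, so the two have the same kernel.\<close>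

lemma syzygy_kernel:
  assumes R: "syzygies M R"
  shows "is_kernel A (bd R i) (syzygy_incl A R i)"
proof (cases i)
  case 0
  then show ?thesis using short_exactD(7)[OF syzygy_short_exact[OF R, of 0]] R by (simp add: syzygies_def)
next
  case (Suc k)
  note j = syzygy_incl[OF R, of k] and cH = cok_Hom[OF R, of i] and jj = syzygy_incl[OF R, of i]
    and se = syzygy_short_exact[OF R, of i]
  have pr: "proper_resolution A W M R" using R by (simp add: syzygies_def)
  note d = proper_resolution_bd(3)[OF pr, of k, folded Suc]
  have z: "bd R i \<cdot> f = zero_mor A V (cx R k) \<longleftrightarrow> cok R i \<cdot> f = zero_mor A V (Omega A R i)"
    if f: "f \<in> Hom A V (cx R i)" for f V
  proof -
    have a: "bd R i \<cdot> f = syzygy_incl A R k \<cdot> (cok R i \<cdot> f)"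
      using comp_assoc[OF f cH j(1)[folded Suc]] j(2)[folded Suc] by simp
    show ?thesis
      unfolding a using comp_zero[OF j(1)[folded Suc] HomD(4)[OF f]]
        monic_zeroD[OF j(3) j(1)[folded Suc] comp_Hom[OF f cH]] by metis
  qed
  show ?thesis
  proof (rule is_kernelI[OF d jj(1) _ jj(3)])
    show "bd R i \<cdot> syzygy_incl A R i = zero_mor A (Omega A R (Suc i)) (cx R k)"
      using z[OF jj(1)] short_exactD(3)[OF se] HomD(2)[OF jj(1)] HomD(3)[OF cH] by simp
    fix V h assume h: "h \<in> Hom A V (cx R i)" "bd R i \<cdot> h = zero_mor A V (cx R k)"
    then show "\<exists>u\<in>Hom A V (Omega A R (Suc i)). syzygy_incl A R i \<cdot> u = h"
      using kernel_factor[OF short_exactD(7)[OF se] cH h(1)] z[OF h(1)] HomD(2)[OF jj(1)] by simp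
  qed
qed

text \<open>For positive \<open>i\<close>, a morphism into the syzygy becomes a cycle one degree
  lower, which properness lifts through the differential; the monic inclusion is then
  cancelled.\<close>

lemma syzygy_precover:
  assumes R: "syzygies M R"
  shows "precover (syzygy_incl A R i) (cok R i)"
proof -
  have pr: "proper_resolution A W M R" using R by (simp add: syzygies_def)
  note cH = cok_Hom[OF R]
  have "\<exists>g\<in>Hom A V (cx R i). cok R i \<cdot> g = f" if V: "V \<in> W" and f: "f \<in> Hom A V (Omega A R i)" for V f
  proof (cases i)
    case 0
    then show ?thesis
      using proper_resolution_lift(1)[OF pr V] f Omega_0[OF R] R by (simp add: syzygies_def)
  next
    case (Suc k)
    note j = syzygy_incl[OF R, of k, folded Suc]
    have jf: "syzygy_incl A R k \<cdot> f \<in> Hom A V (cx R k)" using comp_Hom f j by blast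
    have bH: "bd R k \<in> Hom A (cx R k) (tgt A (bd R k))"
      using proper_resolution_bd[OF pr] by (cases k) (auto simp: Hom_def)
    have "bd R k \<cdot> (syzygy_incl A R k \<cdot> f) = zero_mor A V (tgt A (bd R k))"
      using comp_assoc[OF f j(1) bH] kernelD(2)[OF syzygy_kernel[OF R, of k] bH] HomD(2)[OF j(1)]
        zero_comp[OF f HomD(5)[OF bH]] by simp
    then obtain g where g: "g \<in> Hom A V (cx R i)" "bd R i \<cdot> g = syzygy_incl A R k \<cdot> f"
      using proper_resolution_lift(2)[OF pr V jf] Suc by blast
    have "syzygy_incl A R k \<cdot> (cok R i \<cdot> g) = syzygy_incl A R k \<cdot> f"
      using comp_assoc[OF g(1) cH j(1)] j(2) g(2) by simp
    then have "cok R i \<cdot> g = f" using monicD[OF j(3) j(1) comp_Hom[OF g(1) cH] f] by simp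
    then show ?thesis using g by blast
  qed
  then show ?thesis
    unfolding precover_def
    using syzygy_short_exact[OF R] proper_resolution_bd(1)[OF pr] HomD(2,3)[OF cH[of i]] by simp
qed

lemma syzygy_special_precover:
  assumes "special_proper_resolution A W M R"
  shows "special_precover A W (Omega A R i) (syzygy_seq A R i)"
proof -
  note R = syzygies_special[OF assms]
  have "Omega A R (Suc i) \<in> right_perp A W" using assms by (simp add: special_proper_resolution_def)
  then show ?thesis
    using syzygy_precover[OF R, of i] HomD(2)[OF syzygy_incl(1)[OF R, of i]]
    by (simp add: special_precover_def syzygy_seq_def extensions_def precover_def Omega_def)
qed

text \<open>Uniqueness of syzygies up to objects of \<open>W\<close>, a form of Schanuel's lemma.\<close>

lemma syzygies_compare:
  assumes R: "syzygies M R" and S: "syzygies M S"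
  shows "\<exists>f\<in>Hom A (Omega A S i) (Omega A R i). \<exists>g\<in>Hom A (Omega A R i) (Omega A S i).
    \<exists>d\<in>factoring A W (Omega A S i) (Omega A S i). idt A (Omega A S i) = d \<boxplus> (g \<cdot> f)"
proof (induction i)
  case 0
  have M: "M \<in> obj A" using Omega_obj[OF R, of 0] Omega_0[OF R] by simp
  have "idt A M = zero_mor A M M \<boxplus> (idt A M \<cdot> idt A M)"
    using M zero_plus[OF idt_Hom[OF M]] by simp
  then show ?case
    unfolding Omega_0[OF R] Omega_0[OF S] using zero_factoring[OF M M] idt_Hom[OF M] by blast
next
  case (Suc i)
  let ?jS = "syzygy_incl A S i" and ?pS = "cok S i" and ?jR = "syzygy_incl A R i" and ?pR = "cok R i"
  note pc = syzygy_precover[OF S, of i] syzygy_precover[OF R, of i]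
  note se = syzygy_short_exact[OF S, of i] syzygy_short_exact[OF R, of i]
  have t: "tgt A ?pS = Omega A S i" "tgt A ?pR = Omega A R i" by (simp_all add: Omega_def)
  have s: "src A ?jS = Omega A S (Suc i)" "src A ?jR = Omega A R (Suc i)"
    using HomD(2)[OF syzygy_incl(1)] S R by blast+
  obtain f g d where f: "f \<in> Hom A (Omega A S i) (Omega A R i)" and g: "g \<in> Hom A (Omega A R i) (Omega A S i)"
    and d: "d \<in> factoring A W (Omega A S i) (Omega A S i)" and id: "idt A (Omega A S i) = d \<boxplus> (g \<cdot> f)"
    using Suc by blast
  obtain f' bf where lf: "ladder A (?jS, ?pS) (?jR, ?pR) f' bf f"
    using ex_ladder[OF pc, of f] f t by auto
  obtain g' bg where lg: "ladder A (?jR, ?pR) (?jS, ?pS) g' bg g"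
    using ex_ladder[OF pc(2,1), of g] g t by auto
  \<comment> \<open>The identity ladder and this composite have right ends differing by
    \<open>d\<close>, so their left ends differ by a morphism factoring through
    \<open>W\<close>.\<close>
  have "ladder A (?jS, ?pS) (?jS, ?pS) (g' \<cdot> f') (bg \<cdot> bf) (g \<cdot> f)"
    using ladder_comp[OF lf lg] se by simp
  then have "\<exists>e\<in>factoring A W (src A ?jS) (src A ?jS). idt A (src A ?jS) = e \<boxplus> (g' \<cdot> f')"
    using ladder_stable[OF pc(1,1) ladder_idt[OF se(1)], of "g' \<cdot> f'" "bg \<cdot> bf" "g \<cdot> f" d] id d t by simp
  then show ?case using ladderD(1)[OF lf se] ladderD(1)[OF lg se(2,1)] s by auto
qed

text \<open>The syzygy of \<open>R\<close> is a quotient of a zero object, so the composite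
  \<open>g \<cdot> f\<close> through it vanishes and only \<open>d\<close> remains.\<close>

lemma idt_syzygy_factoring:
  assumes R: "syzygies M R" and S: "syzygies M S" and z: "zero_object A (cx R i)"
  shows "idt A (Omega A S i) \<in> factoring A W (Omega A S i) (Omega A S i)"
proof -
  obtain f g d where f: "f \<in> Hom A (Omega A S i) (Omega A R i)" and g: "g \<in> Hom A (Omega A R i) (Omega A S i)"
    and d: "d \<in> factoring A W (Omega A S i) (Omega A S i)" and id: "idt A (Omega A S i) = d \<boxplus> (g \<cdot> f)"
    using syzygies_compare[OF R S] by blast
  note c = cok_Hom[OF R, of i] and K = Omega_obj[OF R, of i] and L = Omega_obj[OF S, of i]
  have "idt A (Omega A R i) = zero_mor A (Omega A R i) (Omega A R i)"
    using epic_zeroD[OF cokernel_epic[OF cok_cokernel[OF R]] c idt_Hom[OF K]]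
      zero_object_Hom(2)[OF z c] idt_comp[OF c] by simp
  then have "f = zero_mor A (Omega A S i) (Omega A R i)"
    using idt_comp[OF f] zero_comp[OF f K] by simp
  then have "g \<cdot> f = zero_mor A (Omega A S i) (Omega A S i)" using comp_zero[OF g L] by simp
  then show ?thesis using id d zero_plus[OF factoring_Hom[OF d]] by simp
qed

text \<open>\<open>closed_under_summands\<close> asks for a biproduct, so the split epic
  \<open>h\<close> has to be completed by a second summand, namely its kernel.\<close>

lemma summand_in_W:
  assumes cl: "closed_under_summands A W" and f: "idt A X \<in> factoring A W X X"
  shows "X \<in> W"
proof -
  obtain V g h where V: "V \<in> W" and g: "g \<in> Hom A X V" and h: "h \<in> Hom A V X" and hg: "h \<cdot> g = idt A X"
    using f by (force simp: factoring_def)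
  note X = HomD(4)[OF g] and Vo = HomD(5)[OF g]
  obtain k where k: "is_kernel A h k" using ex_kernel HomD(1)[OF h] by blast
  define Y where "Y = src A k"
  have kH: "k \<in> Hom A Y V" and hk: "h \<cdot> k = zero_mor A Y X" using kernelD[OF k h] by (simp_all add: Y_def)
  note Y = HomD(4)[OF kH] and m = kernel_monic[OF k]
  have gh: "g \<cdot> h \<in> Hom A V V" using comp_Hom h g by blast
  \<comment> \<open>The idempotent \<open>1 - g h\<close> projects onto the kernel of
    \<open>h\<close>; its factor \<open>r\<close> through \<open>k\<close> is the second
    projection.\<close>
  obtain e where e: "e \<in> Hom A V V" "idt A V = e \<boxplus> (g \<cdot> h)" using ex_minus[OF idt_Hom[OF Vo] gh] by blast
  have "(h \<cdot> e) \<boxplus> h = zero_mor A V X \<boxplus> h"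
    using comp_plus[OF e(1) gh h] e(2) comp_idt[OF h] comp_assoc[OF h g h] hg idt_comp[OF h] zero_plus[OF h] by simp
  then have "h \<cdot> e = zero_mor A V X"
    using plus_right_cancel[OF comp_Hom[OF e(1) h] zero_Hom[OF Vo X] h] by simp
  then obtain r where r: "r \<in> Hom A V Y" "k \<cdot> r = e" using kernel_factor[OF k h e(1)] Y_def by blast
  have "e \<cdot> k = k"
    using plus_comp[OF kH e(1) gh] e(2) idt_comp[OF kH] comp_assoc[OF kH h g] hk comp_zero[OF g Y]
      zero_plus[OF comp_Hom[OF kH e(1)]] by simp
  then have "k \<cdot> (r \<cdot> k) = k \<cdot> idt A Y" using comp_assoc[OF kH r(1) kH] r(2) comp_idt[OF kH] by simp
  then have rk: "r \<cdot> k = idt A Y" using monicD[OF m kH comp_Hom[OF kH r(1)] idt_Hom[OF Y]] by simp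
  have "(e \<cdot> g) \<boxplus> g = zero_mor A X V \<boxplus> g"
    using plus_comp[OF g e(1) gh] e(2) idt_comp[OF g] comp_assoc[OF g h g] hg comp_idt[OF g] zero_plus[OF g] by simp
  then have "e \<cdot> g = zero_mor A X V"
    using plus_right_cancel[OF comp_Hom[OF g e(1)] zero_Hom[OF X Vo] g] by simp
  then have "k \<cdot> (r \<cdot> g) = zero_mor A X V" using comp_assoc[OF g r(1) kH] r(2) by simp
  then have rg: "r \<cdot> g = zero_mor A X Y" using monic_zeroD[OF m kH comp_Hom[OF g r(1)]] by simp
  have "(g \<cdot> h) \<boxplus> (k \<cdot> r) = idt A V" using e(2) r(2) plus_commute[OF e(1) gh] by simp
  then have "biproduct A X Y V g k h r"
    using g kH h r(1) hg rk hk rg by (simp add: biproduct_def)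
  then show ?thesis using cl V unfolding closed_under_summands_def is_direct_sum_def by blast
qed

text \<open>Above degree \<open>m\<close> all new differentials are monic, which settles exactness
  there, also under \<open>Hom(V, -)\<close>. In degree \<open>m\<close> the syzygy inclusion is the
  kernel of \<open>bd S m\<close>, and \<open>Hom(V, -)\<close> preserves kernels.\<close>

lemma truncated_resolution:
  assumes S: "syzygies M S" and W': "Omega A S (Suc m) \<in> W"
  shows "\<exists>R :: ('o, 'm) resolution. proper_resolution A W M R \<and> (\<forall>n>Suc m. zero_object A (cx R n))"
proof -
  obtain Z where Z: "Z \<in> W" "zero_object A Z" using additive unfolding additive_subcategory_def by blast
  note Zo = W_obj[OF Z(1)]
  let ?L = "Omega A S (Suc m)" and ?j = "syzygy_incl A S m"
  have pr: "proper_resolution A W M S" using S by (simp add: syzygies_def)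
  define C where "C n = (if n \<le> m then cx S n else if n = Suc m then ?L else Z)" for n
  \<comment> \<open>Cutting at \<open>Suc m\<close> keeps the augmentation \<open>bd S 0\<close>
    even for \<open>m = 0\<close>. In the zero range the target of \<open>B n\<close> is the
    preceding term \<open>C (n - 1)\<close>.\<close>
  define B where "B n = (if n \<le> m then bd S n else if n = Suc m then ?j else zero_mor A Z (C (n - 1)))" for n
  have CW: "C n \<in> W" for n using W' Z proper_resolution_bd(1)[OF pr] by (auto simp: C_def)
  note Co = W_obj[OF CW]
  note j = syzygy_incl[OF S, of m]
  have B0: "B 0 = bd S 0" and C0: "C 0 = cx S 0" by (simp_all add: B_def C_def)
  have BS: "B (Suc n) \<in> Hom A (C (Suc n)) (C n)" for n
    using proper_resolution_bd(3)[OF pr, of n] j(1) zero_Hom[OF Zo Co[of n]] by (auto simp: B_def C_def)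
  have hi: "monic A (B n)" "C (Suc n) = Z" "B (Suc n) = zero_mor A Z (C n)" if n: "n > m" for n
  proof -
    show "monic A (B n)"
    proof (cases "n = Suc m")
      case True
      then show ?thesis using j(3) by (simp add: B_def)
    next
      case False
      then have nn: "C n = Z" "n = Suc (n - 1)" using n by (auto simp: C_def)
      have "B n \<in> Hom A Z (C (n - 1))" using BS[of "n - 1"] nn by simp
      then show ?thesis using zero_object_Hom(1)[OF Z(2)] by (intro monicI) auto
    qed
  qed (use n in \<open>auto simp: C_def B_def\<close>)
  have mid: "B m = bd S m" "B (Suc m) = ?j" "C m = cx S m" "C (Suc m) = ?L" by (simp_all add: B_def C_def)
  have lo: "B n = bd S n" "C n = cx S n" if "n \<le> m" for n using that by (simp_all add: B_def C_def)
  have ex: "exact_at A (B (Suc (Suc n))) (B (Suc n))" for n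
  proof -
    consider "Suc (Suc n) \<le> m" | "Suc n = m" | "Suc n > m" by linarith
    then show ?thesis
    proof cases
      case 1
      then show ?thesis using pr lo by (simp add: proper_resolution_def)
    next
      case 2
      have "exact_at A ?j (bd S m)"
        using exact_at_kernel[OF syzygy_short_exact[OF S] syzygy_kernel[OF S]] .
      then show ?thesis using mid 2 by simp
    next
      case 3
      then show ?thesis using exact_at_zero_monic[OF Z(2) hi(1) BS] hi(3) by simp
    qed
  qed
  \<comment> \<open>For \<open>m = 0\<close> the map into degree zero is the syzygy inclusion
    instead of a differential of \<open>S\<close>.\<close>
  have cok0: "is_cokernel A (B 1) (B 0)"
  proof (cases "m = 0")
    case True
    then show ?thesis
      using short_exactD(8)[OF syzygy_short_exact[OF S, of 0]] S by (simp add: B_def syzygies_def)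
  next
    case False
    then show ?thesis using pr lo by (simp add: proper_resolution_def)
  qed
  have hom: "{f \<in> Hom A V (C n). B n \<cdot> f = zero_mor A V (tgt A (B n))} = (\<lambda>g. B (Suc n) \<cdot> g) ` Hom A V (C (Suc n))"
    if V: "V \<in> W" for V n
  proof -
    note Vo = W_obj[OF V]
    consider "Suc n \<le> m" | "n = m" | "n > m" by linarith
    then show ?thesis
    proof cases
      case 1
      then show ?thesis using pr lo V by (simp add: proper_resolution_def)
    next
      case 2
      note k = syzygy_kernel[OF S, of m]
      have bH: "bd S m \<in> Hom A (cx S m) (tgt A (bd S m))"
        using proper_resolution_bd[OF pr] by (cases m) (auto simp: Hom_def)
      have "{f \<in> Hom A V (cx S m). bd S m \<cdot> f = zero_mor A V (tgt A (bd S m))} = (\<lambda>g. ?j \<cdot> g) ` Hom A V ?L"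
      proof (intro equalityI subsetI)
        fix f assume "f \<in> {f \<in> Hom A V (cx S m). bd S m \<cdot> f = zero_mor A V (tgt A (bd S m))}"
        then show "f \<in> (\<lambda>g. ?j \<cdot> g) ` Hom A V ?L"
          using kernel_factor[OF k bH, of f V] HomD(2)[OF j(1)] by auto
      next
        fix f assume "f \<in> (\<lambda>g. ?j \<cdot> g) ` Hom A V ?L"
        then obtain g where g: "g \<in> Hom A V ?L" "f = ?j \<cdot> g" by blast
        have "bd S m \<cdot> f = zero_mor A V (tgt A (bd S m))"
          using comp_assoc[OF g(1) j(1) bH] g(2) kernelD(2)[OF k bH] HomD(2)[OF j(1)] zero_comp[OF g(1) HomD(5)[OF bH]]
          by simp
        then show "f \<in> {f \<in> Hom A V (cx S m). bd S m \<cdot> f = zero_mor A V (tgt A (bd S m))}"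
          using comp_Hom[OF g(1) j(1)] g(2) by blast
      qed
      then show ?thesis using 2 mid by simp
    next
      case 3
      then obtain l where l: "n = Suc l" by (cases n) auto
      note b = BS[of l, folded l]
      have "{f \<in> Hom A V (C n). B n \<cdot> f = zero_mor A V (tgt A (B n))} = {zero_mor A V (C n)}"
        using monic_zeroD[OF hi(1)[OF 3] b] zero_Hom[OF Vo Co] comp_zero[OF b Vo] HomD(3)[OF b] by auto
      moreover have "zero_mor A Z (C n) \<cdot> g = zero_mor A V (C n)" if "g \<in> Hom A V Z" for g
        using zero_comp[OF that Co] .
      then have "(\<lambda>g. B (Suc n) \<cdot> g) ` Hom A V (C (Suc n)) = {zero_mor A V (C n)}"
        using zero_Hom[OF Vo Zo] hi(2,3)[OF 3] by auto
      ultimately show ?thesis by simp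
    qed
  qed
  have "proper_resolution A W M \<lparr>cx = C, bd = B\<rparr>"
    unfolding proper_resolution_def using CW BS ex cok0 hom B0 C0 proper_resolution_bd(2)[OF pr] pr
    by (simp add: proper_resolution_def)
  moreover have "\<forall>n>Suc m. zero_object A (cx \<lparr>cx = C, bd = B\<rparr> n)" using Z(2) by (simp add: C_def)
  ultimately show ?thesis by blast
qed

section \<open>Finite \<open>W\<close>-projective dimension and bounded resolutions\<close>

lemma ex_syzygies:
  fixes R :: "('o, 'm) resolution"
  assumes "proper_resolution A W M R"
  shows "\<exists>S. syzygies M S \<and> cx S = cx R"
proof -
  have "\<exists>q. is_cokernel A (bd R (Suc i)) q" for i
    using ex_cokernel HomD(1)[OF proper_resolution_bd(3)[OF assms]] by blast
  then obtain c where c: "is_cokernel A (bd R (Suc i)) (c i)" for i by metis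
  \<comment> \<open>Index \<open>0\<close> is overwritten because the zeroth syzygy has to be
    \<open>M\<close> itself and not just isomorphic to it.\<close>
  let ?S = "\<lparr>cx = cx R, bd = bd R, cok = c(0 := bd R 0)\<rparr>"
  have "syzygies M ?S" using assms c by (simp add: syzygies_def proper_resolution_def)
  then show ?thesis by (intro exI[of _ ?S]) simp
qed

lemma W_pd_finite_iff:
  "W_pd A W M < \<infinity> \<longleftrightarrow> (\<exists>R :: ('o, 'm) resolution. \<exists>d. proper_resolution A W M R \<and> (\<forall>n>d. zero_object A (cx R n)))"
proof
  assume "W_pd A W M < \<infinity>"
  then obtain R :: "('o, 'm) resolution" where R: "proper_resolution A W M R"
    and s: "(SUP n \<in> {n. \<not> zero_object A (cx R n)}. ereal (real n)) < \<infinity>"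
    unfolding W_pd_def INF_less_iff by blast
  \<comment> \<open>A natural number above the supremum also exists when all terms are zero and the
    supremum is \<open>-\<infinity>\<close>.\<close>
  from s obtain d :: nat where d: "(SUP n \<in> {n. \<not> zero_object A (cx R n)}. ereal (real n)) < ereal (real d)"
    using less_PInf_Ex_of_nat by auto
  have "zero_object A (cx R n)" if n: "n > d" for n
  proof (rule ccontr)
    assume "\<not> zero_object A (cx R n)"
    then have "ereal (real n) \<le> (SUP n \<in> {n. \<not> zero_object A (cx R n)}. ereal (real n))"
      by (intro SUP_upper) simp
    then show False using le_less_trans[OF _ d] n by fastforce
  qed
  then show "\<exists>R :: ('o, 'm) resolution. \<exists>d. proper_resolution A W M R \<and> (\<forall>n>d. zero_object A (cx R n))"
    using R by blast
next
  assume "\<exists>R :: ('o, 'm) resolution. \<exists>d. proper_resolution A W M R \<and> (\<forall>n>d. zero_object A (cx R n))"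
  then obtain R :: "('o, 'm) resolution" and d where R: "proper_resolution A W M R"
    and z: "\<forall>n>d. zero_object A (cx R n)" by blast
  have "W_pd A W M \<le> (SUP n \<in> {n. \<not> zero_object A (cx R n)}. ereal (real n))"
    unfolding W_pd_def using R by (intro INF_lower) simp
  also have "\<dots> \<le> ereal (real d)"
    using z by (intro SUP_least) (metis (mono_tags, lifting) ereal_less_eq(3) mem_Collect_eq not_le_imp_less of_nat_mono)
  also have "\<dots> < \<infinity>" by simp
  finally show "W_pd A W M < \<infinity>" .
qed

end

section \<open>Sequential colimits\<close>

lemma fold_closed:
  assumes closed: "\<And>i x. i0 \<le> i \<Longrightarrow> x \<in> carrier (G i) \<Longrightarrow> \<phi> i x \<in> carrier (G (Suc i))"
    and "i0 \<le> i" "i \<le> k" "x \<in> carrier (G i)"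
  shows "fold \<phi> [i..<k] x \<in> carrier (G k)"
  using \<open>i \<le> k\<close>
proof (induction k rule: dec_induct)
  case (step k)
  then show ?case using closed[of k] assms(2) by simp
qed (use assms in simp)

text \<open>Any two elements meet at a stage beyond \<open>N\<close>, where the group has one
  element. The relation is thus total on the disjoint union, and the colimit is a single
  class.\<close>

lemma trivial_seq_colimI:
  assumes closed: "\<And>i x. i0 \<le> i \<Longrightarrow> x \<in> carrier (G i) \<Longrightarrow> \<phi> i x \<in> carrier (G (Suc i))"
    and grp: "\<And>i. i0 \<le> i \<Longrightarrow> group (G i)"
    and triv: "\<And>i. i0 \<le> i \<Longrightarrow> N \<le> i \<Longrightarrow> carrier (G i) \<subseteq> {\<one>\<^bsub>G i\<^esub>}"
  shows "trivial_group (seq_colim i0 G \<phi>)"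
proof -
  define S where "S = (SIGMA i:{i0..}. carrier (G i))"
  let ?r = "colim_rel i0 G \<phi>"
  have rel: "(a, b) \<in> ?r" if "a \<in> S" "b \<in> S" for a b
  proof -
    obtain i x j y where ab: "a = (i, x)" "b = (j, y)" by (cases a, cases b)
    then have h: "i0 \<le> i" "x \<in> carrier (G i)" "i0 \<le> j" "y \<in> carrier (G j)" using that by (auto simp: S_def)
    define k where "k = max N (max i j)"
    have k: "i \<le> k" "j \<le> k" "N \<le> k" by (auto simp: k_def)
    have "fold \<phi> [i..<k] x \<in> carrier (G k)" "fold \<phi> [j..<k] y \<in> carrier (G k)"
      using fold_closed[of i0 G \<phi>] closed h k by metis+
    then have "fold \<phi> [i..<k] x = fold \<phi> [j..<k] y"
      using triv[of k] h k by (metis le_trans singletonD subsetD)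
    then show ?thesis using h k by (auto simp: ab colim_rel_def)
  qed
  have sub: "?r \<subseteq> S \<times> S" by (auto simp: colim_rel_def S_def)
  have one: "(i0, \<one>\<^bsub>G i0\<^esub>) \<in> S"
    using monoid.one_closed[OF group.is_monoid[OF grp[of i0]]] by (simp add: S_def)
  \<comment> \<open>Carrier, unit and product are all formed as images under the relation, so this
    one fact computes the three of them.\<close>
  have img: "?r `` X = S" if "X \<subseteq> S" "X \<noteq> {}" for X
    using rel sub that by blast
  have car: "carrier (seq_colim i0 G \<phi>) = {S}"
  proof -
    have "S // ?r = {S}" using img one by (auto simp: quotient_def)
    then show ?thesis by (simp add: seq_colim_def S_def)
  qed
  have o: "\<one>\<^bsub>seq_colim i0 G \<phi>\<^esub> = S" using img one by (simp add: seq_colim_def)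
  have m: "S \<otimes>\<^bsub>seq_colim i0 G \<phi>\<^esub> S = S"
  proof -
    let ?X = "{(i, x \<otimes>\<^bsub>G i\<^esub> y) | i x y. (i, x) \<in> S \<and> (i, y) \<in> S}"
    have "?X \<subseteq> S" using monoid.m_closed[OF group.is_monoid[OF grp]] by (auto simp: S_def)
    moreover have "?X \<noteq> {}" using one by blast
    ultimately have "?r `` ?X = S" by (rule img)
    then show ?thesis by (simp add: seq_colim_def)
  qed
  have "group (seq_colim i0 G \<phi>)" by (rule groupI) (use car o m in auto)
  then show ?thesis using car o by (simp add: trivial_group_def)
qed

lemma trivial_seq_colimD:
  assumes "trivial_group (seq_colim i0 G \<phi>)" "x \<in> carrier (G i0)" "y \<in> carrier (G i0)"
  shows "\<exists>k>i0. fold \<phi> [i0..<k] x = fold \<phi> [i0..<k] y"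
proof -
  let ?r = "colim_rel i0 G \<phi>"
  have "?r `` {(i0, z)} \<in> carrier (seq_colim i0 G \<phi>)" if "z \<in> carrier (G i0)" for z
    using that by (auto simp: seq_colim_def intro!: quotientI)
  then have "?r `` {(i0, x)} = ?r `` {(i0, y)}" using assms by (auto simp: trivial_group_def)
  moreover have "((i0, y), (i0, y)) \<in> ?r" using assms(3) by (auto simp: colim_rel_def)
  ultimately have "((i0, x), (i0, y)) \<in> ?r" by blast
  then obtain k where "i0 \<le> k" "fold \<phi> [i0..<k] x = fold \<phi> [i0..<k] y" by (auto simp: colim_rel_def)
  \<comment> \<open>One further transition map makes the stage strictly later than
    \<open>i0\<close>.\<close>
  then have "fold \<phi> [i0..<Suc k] x = fold \<phi> [i0..<Suc k] y" "i0 < Suc k" by simp_all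
  then show ?thesis by blast
qed

section \<open>Vanishing of complete cohomology\<close>

context abelian_subcategory
begin

lemma stable_hom_trivial:
  assumes M: "M \<in> obj A" and N: "N \<in> obj A"
    and id: "idt A M \<in> factoring A W M M \<or> idt A N \<in> factoring A W N N"
  shows "carrier (stable_hom A W M N) \<subseteq> {\<one>\<^bsub>stable_hom A W M N\<^esub>}"
proof -
  have "f \<in> factoring A W M N" if f: "f \<in> Hom A M N" for f
    using id comp_factoring[OF _ f, of "idt A M" M] factoring_comp[OF _ f, of "idt A N" N] comp_idt[OF f] idt_comp[OF f]
    by auto
  then show ?thesis
    unfolding carrier_stable_hom one_stable_hom[OF M N] using stable_class_eq_zero by blast
qed

lemma Lambda_syzygy:
  assumes R: "special_proper_resolution A W M R" and S: "special_proper_resolution A W N S"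
    and l: "ladder A (syzygy_seq A R k) (syzygy_seq A S i) g b f"
  shows "Lambda A W (syzygy_seq A R k) (syzygy_seq A S i) (stable_class A W (Omega A R k) (Omega A S i) f)
    = stable_class A W (Omega A R (Suc k)) (Omega A S (Suc i)) g"
  using Lambda_stable_class[OF syzygy_special_precover[OF R, of k, unfolded syzygy_seq_def] syzygy_special_precover[OF S, of i, unfolded syzygy_seq_def]
      l[unfolded syzygy_seq_def]]
    HomD(2)[OF syzygy_incl(1)[OF syzygies_special[OF R]]] HomD(2)[OF syzygy_incl(1)[OF syzygies_special[OF S]]]
  by (simp add: syzygy_seq_def)

lemma Lambda_closed:
  assumes R: "special_proper_resolution A W M R" and S: "special_proper_resolution A W N S"
    and x: "x \<in> carrier (stable_hom A W (Omega A R k) (Omega A S i))"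
  shows "Lambda A W (syzygy_seq A R k) (syzygy_seq A S i) x
    \<in> carrier (stable_hom A W (Omega A R (Suc k)) (Omega A S (Suc i)))"
proof -
  note R' = syzygies_special[OF R] and S' = syzygies_special[OF S]
  obtain f where f: "f \<in> Hom A (Omega A R k) (Omega A S i)" and x: "x = stable_class A W (Omega A R k) (Omega A S i) f"
    using x by (auto simp: carrier_stable_hom)
  obtain g b where l: "ladder A (syzygy_seq A R k) (syzygy_seq A S i) g b f"
    using ex_ladder[OF syzygy_precover[OF R', of k] syzygy_precover[OF S', of i], of f] f
    by (auto simp: syzygy_seq_def Omega_def)
  have "g \<in> Hom A (Omega A R (Suc k)) (Omega A S (Suc i))"
    using ladderD(1)[OF l[unfolded syzygy_seq_def] syzygy_short_exact[OF R'] syzygy_short_exact[OF S']]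
      HomD(2)[OF syzygy_incl(1)[OF R']] HomD(2)[OF syzygy_incl(1)[OF S']] by simp
  then show ?thesis using Lambda_syzygy[OF R S l] x by (simp add: carrier_stable_hom)
qed

lemma Ext_hat_trivial:
  assumes res: "\<And>U. U \<in> obj A \<Longrightarrow> special_proper_resolution A W U (res U)"
    and M: "M \<in> obj A" and N: "N \<in> obj A"
    and id: "(\<forall>i>d. idt A (Omega A (res M) i) \<in> factoring A W (Omega A (res M) i) (Omega A (res M) i)) \<or>
      (\<forall>i>d. idt A (Omega A (res N) i) \<in> factoring A W (Omega A (res N) i) (Omega A (res N) i))"
  shows "trivial_group (Ext_hat A W res n M N)"
  unfolding Ext_hat_def
\<comment> \<open>From this bound on both indices \<open>i\<close> and \<open>i + n\<close> exceed
  \<open>d\<close>, whichever sign \<open>n\<close> has.\<close>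
proof (rule trivial_seq_colimI[where N = "Suc d + nat (- n)"])
  note o = Omega_obj[OF syzygies_special[OF res[OF M]]] Omega_obj[OF syzygies_special[OF res[OF N]]]
  fix i assume i: "nat (max 0 (- n)) \<le> i"
  show "group (stable_hom A W (Omega A (res M) (nat (int i + n))) (Omega A (res N) i))"
    using group_stable_hom o by blast
  \<comment> \<open>At the indices of the system \<open>i + n\<close> is nonnegative, so
    \<open>nat\<close> commutes with the successor.\<close>
  have "nat (int (Suc i) + n) = Suc (nat (int i + n))" using i by linarith
  then show "Lambda A W (syzygy_seq A (res M) (nat (int i + n))) (syzygy_seq A (res N) i) x
    \<in> carrier (stable_hom A W (Omega A (res M) (nat (int (Suc i) + n))) (Omega A (res N) (Suc i)))"
    if "x \<in> carrier (stable_hom A W (Omega A (res M) (nat (int i + n))) (Omega A (res N) i))" for x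
    using Lambda_closed[OF res[OF M] res[OF N] that] by simp
  assume "Suc d + nat (- n) \<le> i"
  then have "i > d" "nat (int i + n) > d" by linarith+
  then show "carrier (stable_hom A W (Omega A (res M) (nat (int i + n))) (Omega A (res N) i))
    \<subseteq> {\<one>\<^bsub>stable_hom A W (Omega A (res M) (nat (int i + n))) (Omega A (res N) i)\<^esub>}"
    using stable_hom_trivial o id by blast
qed

lemma idt_factoring_of_Ext_hat:
  assumes res: "\<And>U. U \<in> obj A \<Longrightarrow> special_proper_resolution A W U (res U)"
    and M: "M \<in> obj A" and triv: "trivial_group (Ext_hat A W res 0 M M)"
  shows "\<exists>m. idt A (Omega A (res M) (Suc m)) \<in> factoring A W (Omega A (res M) (Suc m)) (Omega A (res M) (Suc m))"
proof -
  define \<Omega> where "\<Omega> = Omega A (res M)"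
  define \<phi> where "\<phi> i = Lambda A W (syzygy_seq A (res M) i) (syzygy_seq A (res M) i)" for i
  note sp = res[OF M] and R = syzygies_special[OF res[OF M]]
  have o: "\<Omega> i \<in> obj A" for i using Omega_obj[OF R] by (simp add: \<Omega>_def)
  have s: "src A (syzygy_incl A (res M) i) = \<Omega> (Suc i)" "tgt A (cok (res M) i) = \<Omega> i" for i
    using HomD(2)[OF syzygy_incl(1)[OF R]] by (simp_all add: \<Omega>_def Omega_def)
  have id: "\<phi> i (stable_class A W (\<Omega> i) (\<Omega> i) (idt A (\<Omega> i))) =
      stable_class A W (\<Omega> (Suc i)) (\<Omega> (Suc i)) (idt A (\<Omega> (Suc i)))" for i
    unfolding \<phi>_def \<Omega>_def
    using Lambda_syzygy[OF sp sp] ladder_idt[OF syzygy_short_exact[OF R, of i]] s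
    by (simp add: syzygy_seq_def \<Omega>_def)
  have zero: "\<phi> i (stable_class A W (\<Omega> i) (\<Omega> i) (zero_mor A (\<Omega> i) (\<Omega> i))) =
      stable_class A W (\<Omega> (Suc i)) (\<Omega> (Suc i)) (zero_mor A (\<Omega> (Suc i)) (\<Omega> (Suc i)))" for i
    unfolding \<phi>_def \<Omega>_def
    using Lambda_syzygy[OF sp sp] ladder_zero[OF syzygy_short_exact[OF R, of i] syzygy_short_exact[OF R, of i]] s
    by (simp add: syzygy_seq_def \<Omega>_def)
  have "trivial_group (seq_colim 0 (\<lambda>i. stable_hom A W (\<Omega> i) (\<Omega> i)) \<phi>)"
    using triv by (simp add: Ext_hat_def \<Omega>_def \<phi>_def[abs_def])
  moreover have classes: "stable_class A W (\<Omega> 0) (\<Omega> 0) (idt A (\<Omega> 0)) \<in> carrier (stable_hom A W (\<Omega> 0) (\<Omega> 0))"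
    "stable_class A W (\<Omega> 0) (\<Omega> 0) (zero_mor A (\<Omega> 0) (\<Omega> 0)) \<in> carrier (stable_hom A W (\<Omega> 0) (\<Omega> 0))"
    using idt_Hom[OF o] zero_Hom[OF o o] unfolding carrier_stable_hom by blast+
  ultimately obtain k where k: "k > 0" and eq: "fold \<phi> [0..<k] (stable_class A W (\<Omega> 0) (\<Omega> 0) (idt A (\<Omega> 0)))
      = fold \<phi> [0..<k] (stable_class A W (\<Omega> 0) (\<Omega> 0) (zero_mor A (\<Omega> 0) (\<Omega> 0)))"
    using trivial_seq_colimD[of 0 "\<lambda>i. stable_hom A W (\<Omega> i) (\<Omega> i)" \<phi>] classes by blast
  have "fold \<phi> [0..<k] (stable_class A W (\<Omega> 0) (\<Omega> 0) (idt A (\<Omega> 0))) = stable_class A W (\<Omega> k) (\<Omega> k) (idt A (\<Omega> k))" for k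
    by (induction k) (simp_all add: id)
  moreover have "fold \<phi> [0..<k] (stable_class A W (\<Omega> 0) (\<Omega> 0) (zero_mor A (\<Omega> 0) (\<Omega> 0)))
      = stable_class A W (\<Omega> k) (\<Omega> k) (zero_mor A (\<Omega> k) (\<Omega> k))" for k
    by (induction k) (simp_all add: zero)
  ultimately have "idt A (\<Omega> k) \<in> factoring A W (\<Omega> k) (\<Omega> k)"
    using eq stable_class_eq_zero[OF idt_Hom[OF o]] by simp
  \<comment> \<open>A positive \<open>k\<close> is a successor, the form in which the truncation
    takes its index.\<close>
  then show ?thesis using k unfolding \<Omega>_def by (metis Suc_pred)
qed

end

theorem theorem4p11:
  fixes A :: "('o, 'm) precat"
    and W :: "'o set"
    and res :: "'o \<Rightarrow> ('o, 'm) syzygy_resolution"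
    and M :: 'o
  assumes "abelian_category A"
    and "special_precovering A W"
    and "closed_under_summands A W"
    and "\<And>U. U \<in> obj A \<Longrightarrow> special_proper_resolution A W U (res U)"
    and "M \<in> obj A"
  shows "(W_pd A W M < \<infinity> \<longleftrightarrow>
           (\<forall>n::int. \<forall>U\<in>obj A. trivial_group (Ext_hat A W res n U M) \<and>
                               trivial_group (Ext_hat A W res n M U))) \<and>
         ((\<forall>n::int. \<forall>U\<in>obj A. trivial_group (Ext_hat A W res n U M) \<and>
                               trivial_group (Ext_hat A W res n M U)) \<longleftrightarrow>
           trivial_group (Ext_hat A W res 0 M M))"
    (is "(?i \<longleftrightarrow> ?ii) \<and> (?ii \<longleftrightarrow> ?iii)")
proof -
  interpret abelian_subcategory A W
    using assms(1,2) by (simp add: abelian_subcategory_def abelian_subcategory_axioms_def special_precovering_def)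
  note S = syzygies_special[OF assms(4)[OF assms(5)]]
  have "?ii" if "?i"
  proof -
    obtain R :: "('o, 'm) resolution" and d where R: "proper_resolution A W M R"
      and z: "\<forall>n>d. zero_object A (cx R n)"
      using \<open>?i\<close> W_pd_finite_iff by blast
    obtain R' where R': "syzygies M R'" "cx R' = cx R" using ex_syzygies[OF R] by blast
    have "idt A (Omega A (res M) i) \<in> factoring A W (Omega A (res M) i) (Omega A (res M) i)" if "i > d" for i
      using idt_syzygy_factoring[OF R'(1) S] z that R'(2) by simp
    \<comment> \<open>The disjunction assumed in \<open>Ext_hat_trivial\<close> lets
      \<open>M\<close> stand in either argument, which gives both vanishing statements.\<close>
    then show ?ii using Ext_hat_trivial[where res = res, OF assms(4)] assms(5) by blast
  qed
  moreover have "?iii" if "?ii" using that assms(5) by blast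
  moreover have "?i" if "?iii"
  proof -
    obtain m where "idt A (Omega A (res M) (Suc m)) \<in> factoring A W (Omega A (res M) (Suc m)) (Omega A (res M) (Suc m))"
      using idt_factoring_of_Ext_hat[where res = res, OF assms(4) assms(5) \<open>?iii\<close>] by blast
    then have "Omega A (res M) (Suc m) \<in> W" using summand_in_W assms(3) by blast
    then show ?i using truncated_resolution[OF S] W_pd_finite_iff by blast
  qed
  ultimately show ?thesis by blast
qed

end
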